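(* Let $\mathbb{X}\subseteq\mathbb{P}^2$ be a $\Bbbk$-configuration of type $(1,2,\dots,s)$ with $s\ge2$, and assume there are exactly $r$ lines in $\mathbb{P}^2$ containing $s$ points of $\mathbb{X}$, where $1\le r<s$. Then $\Delta\mathbf{H}_{m\mathbb{X}}(ms-1)=r$ for all integers $m\ge s+1$.
   Context: $\Bbbk$ is an algebraically closed field and $R=\Bbbk[x_0,x_1,x_2]$. A $\Bbbk$-configuration of type $(d_1,\dots,d_s)$ is a finite set $\mathbb{X}\subseteq\mathbb{P}^2$ for which there exist integers $1\le d_1<\cdots<d_s$, subsets $\mathbb{X}_1,\dots,\mathbb{X}_s$ of $\mathbb{X}$ and distinct lines $\mathbb{L}_1,\dots,\mathbb{L}_s\subseteq\mathbb{P}^2$ such that (1) $\mathbb{X}=\bigcup_{i=1}^s\mathbb{X}_i$; (2) $|\mathbb{X}_i|=d_i$ and $\mathbb{X}_i\subseteq\mathbb{L}_i$ for each $i$; (3) for $1<i\le s$, $\mathbb{L}_i$ contains no point of $\mathbb{X}_j$ for any $j<i$. For $\mathbb{X}=\{P_1,\dots,P_n\}$ and $m\ge1$, $m\mathbb{X}$ is the fat point scheme with ideal $I_{m\mathbb{X}}=I_{P_1}^m\cap\cdots\cap I_{P_n}^m$, where $I_P$ is the ideal of $P$. $\mathbf{H}_\mathbb{Z}(t)=\dim_\Bbbk R_t-\dim_\Bbbk(I_\mathbb{Z})_t$ and $\Delta\mathbf{H}_\mathbb{Z}(t)=\mathbf{H}_\mathbb{Z}(t)-\mathbf{H}_\mathbb{Z}(t-1)$,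 with $\mathbf{H}_\mathbb{Z}(t)=0$ for $t<0$. *)

theory Defs
  imports "HOL-Computational_Algebra.Polynomial" "HOL-Library.Poly_Mapping" "HOL-Library.Product_Plus"
begin

text \<open>Polynomials in R = k[x0,x1,x2]: finitely supported maps from exponent
  triples (a,b,c) (the monomial x0^a x1^b x2^c) to coefficients; multiplication is
  the convolution product of Poly_Mapping.\<close>
type_synonym 'k poly3 = "(nat \<times> nat \<times> nat) \<Rightarrow>\<^sub>0 'k"

definition mdeg :: "nat \<times> nat \<times> nat \<Rightarrow> nat" where
  "mdeg e = fst e + fst (snd e) + snd (snd e)"

text \<open>F is homogeneous of degree t (the zero polynomial is homogeneous of every degree).\<close>
definition homogeneous :: "nat \<Rightarrow> 'k::comm_ring_1 poly3 \<Rightarrow> bool" where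
  "homogeneous t F \<longleftrightarrow> (\<forall>e\<in>Poly_Mapping.keys F. mdeg e = t)"

definition eval3 :: "'k::comm_ring_1 poly3 \<Rightarrow> 'k \<times> 'k \<times> 'k \<Rightarrow> 'k" where
  "eval3 F p = (\<Sum>e\<in>Poly_Mapping.keys F. Poly_Mapping.lookup F e * fst p ^ fst e * fst (snd p) ^ fst (snd e)
                                 * snd (snd p) ^ snd (snd e))"

inductive_set ideal_gen :: "'k::comm_ring_1 poly3 set \<Rightarrow> 'k poly3 set" for S where
  zero: "0 \<in> ideal_gen S"
| step: "s \<in> S \<Longrightarrow> x \<in> ideal_gen S \<Longrightarrow> c * s + x \<in> ideal_gen S"

fun ideal_pow :: "'k::comm_ring_1 poly3 set \<Rightarrow> nat \<Rightarrow> 'k poly3 set" where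
  "ideal_pow I 0 = UNIV"
| "ideal_pow I (Suc m) = ideal_gen {a * b | a b. a \<in> I \<and> b \<in> ideal_pow I m}"

definition point_ideal :: "'k::comm_ring_1 \<times> 'k \<times> 'k \<Rightarrow> 'k poly3 set" where
  "point_ideal p = ideal_gen {F. (\<exists>t. homogeneous t F) \<and> eval3 F p = 0}"

definition fat_ideal :: "nat \<Rightarrow> ('k::comm_ring_1 \<times> 'k \<times> 'k) set \<Rightarrow> 'k poly3 set" where
  "fat_ideal m X = (\<Inter>p\<in>X. ideal_pow (point_ideal p) m)"

definition psmult :: "'k::comm_ring_1 \<Rightarrow> 'k poly3 \<Rightarrow> 'k poly3" where
  "psmult c F = Poly_Mapping.map (\<lambda>a. c * a) F"

definition Rdeg :: "nat \<Rightarrow> 'k::comm_ring_1 poly3 set" where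
  "Rdeg t = {F. homogeneous t F}"

definition kdim :: "'k::field poly3 set \<Rightarrow> nat" where
  "kdim V = vector_space.dim psmult V"

definition hilb :: "'k::field poly3 set \<Rightarrow> int \<Rightarrow> int" where
  "hilb I t = (if t < 0 then 0
               else int (kdim (Rdeg (nat t) :: 'k poly3 set)) - int (kdim (I \<inter> Rdeg (nat t))))"

definition dhilb :: "'k::field poly3 set \<Rightarrow> int \<Rightarrow> int" where
  "dhilb I t = hilb I t - hilb I (t - 1)"

text \<open>Projective geometry of P^2: points are represented by nonzero vectors;
  two vectors represent the same point iff proportional.\<close>
definition proportional :: "'k::field \<times> 'k \<times> 'k \<Rightarrow> 'k \<times> 'k \<times> 'k \<Rightarrow> bool" where
  "proportional p q \<longleftrightarrow> (\<exists>c. c \<noteq> 0 \<and> q = (c * fst p, c * fst (snd p), c * snd (snd p)))"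

text \<open>A finite set of points of P^2, given by pairwise non-proportional nonzero representatives.\<close>
definition point_set :: "('k::field \<times> 'k \<times> 'k) set \<Rightarrow> bool" where
  "point_set X \<longleftrightarrow> finite X \<and> 0 \<notin> X \<and> (\<forall>p\<in>X. \<forall>q\<in>X. proportional p q \<longrightarrow> p = q)"

text \<open>The line with nonzero coefficient vector a, as the set of all nonzero vectors on it.
  Two coefficient vectors give the same set iff they define the same line.\<close>
definition line :: "'k::field \<times> 'k \<times> 'k \<Rightarrow> ('k \<times> 'k \<times> 'k) set" where
  "line a = {v. v \<noteq> 0 \<and> fst a * fst v + fst (snd a) * fst (snd v) + snd (snd a) * snd (snd v) = 0}"

definition lines :: "('k::field \<times> 'k \<times> 'k) set set" where
  "lines = {line a | a. a \<noteq> 0}"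

definition k_configuration :: "('k::field \<times> 'k \<times> 'k) set \<Rightarrow> nat list \<Rightarrow> bool" where
  "k_configuration X d \<longleftrightarrow> point_set X \<and> length d \<ge> 1 \<and> 1 \<le> d ! 0 \<and> sorted_wrt (<) d \<and>
     (\<exists>Xs L. X = (\<Union>i<length d. Xs i) \<and>
        (\<forall>i<length d. card (Xs i) = d ! i \<and> L i \<in> lines \<and> Xs i \<subseteq> L i) \<and>
        (\<forall>i<length d. \<forall>j<length d. i \<noteq> j \<longrightarrow> L i \<noteq> L j) \<and>
        (\<forall>i<length d. \<forall>j<i. L i \<inter> Xs j = {}))"

end

(* For multiplicities n on X and an integer d let delta(n, d) be the defect: the dimension of the
   space of forms of degree d - 1 vanishing to order n(p) at each p in X, minus the expected
   dimension.  Then delta >= 0 and Delta H_{mX}(ms - 1) = delta(m, ms - 1) - delta(m, ms).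
   Restricting forms to a line A and putting e = sum of n(p) over p in A gives
     delta(n, d) <= delta(n - 1_A, d - 1)            if e <= d,
     delta(n, d) = delta(n - 1_A, d - 1) + (e - d)   if e >= d.
   Splitting off the lines L_s, ..., L_1 in turn, m times over, shows delta(m, ms) = 0.
   The lines with s points may be taken to be L_s, ..., L_{s-r+1}.  In degree ms - 1 each of them
   is split off once with e - d = 1, which contributes r.  What remains has defect 0: after
   splitting off the s-point lines L_i with i > 2 once more, the other L_i with i > 2 twice, and L_2 if it has
   fewer than s points, the two lines joining X_1 to the points of X_2 replace the three further
   lines of two full rounds; this saves one line and leads back to delta(m - 2, (m - 2)s) = 0. *)
theory Submission
  imports Defs
begin

section \<open>Bivariate polynomials and the defect\<close>

text \<open>The defect is the dimension of the first cohomology group of the ideal sheaf of the fat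
  points, twisted by d - 1; its behaviour along a line is obtained here from rank-nullity for
  restriction to that line. The obstacle is the claim that defect 0 remains: for d = ms - 1 one line
  is missing from the m rounds of s lines that bring all multiplicities to 0. It is made up at the
  point w of X_1. As r < s, the lines with s points are among L_2, ..., L_s, and these avoid w;
  hence every line through w has at most s - 1 points. With multiplicities M = m - 2 on such a line,
  their sum lies at least M below Ms, and this slack absorbs the larger multiplicities that w and
  X_2 still have, once M >= 2. Restriction is carried out in one affine chart, where all lines to be
  split off must be graphs over the same axis and all points must be finite. Only finitely many
  lines occur, so such a chart exists over an infinite field; it is chosen after the lines are
  known.\<close>

context vector_space_pair
begin

text \<open>A basis \<open>B0\<close> of the kernel is extended to a basis of \<open>S\<close>, and
  \<open>f\<close> is injective on the span of the added vectors \<open>C\<close>. The finite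
  spanning set makes all bases finite, so that their cardinalities add up.\<close>

lemma rank_nullity_on:
  assumes f: "Vector_Spaces.linear s1 s2 f" and S: "vs1.subspace S" and fin: "finite B" "S \<subseteq> vs1.span B"
  shows "vs1.dim S = vs1.dim {x \<in> S. f x = 0} + vs2.dim (f ` S)"
proof -
  interpret f: Vector_Spaces.linear s1 s2 f by (fact f)
  define K where "K = {x \<in> S. f x = 0}"
  have K: "vs1.subspace K"
    using S by (auto simp: K_def vs1.subspace_def f.add f.scale)
  obtain B0 where B0: "B0 \<subseteq> K" "vs1.independent B0" "K \<subseteq> vs1.span B0"
    using vs1.maximal_independent_subset[of K] by blast
  obtain B1 where B1: "B0 \<subseteq> B1" "B1 \<subseteq> S" "vs1.independent B1" "S \<subseteq> vs1.span B1"
    using vs1.maximal_independent_subset_extend[of B0 S] B0 K_def by blast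
  have finB1: "finite B1"
    using vs1.independent_span_bound[OF fin(1) B1(3)] B1(2) fin(2) by blast
  define C where "C = B1 - B0"
  have Un: "B1 = B0 \<union> C" and disj: "B0 \<inter> C = {}" using B1(1) by (auto simp: C_def)
  \<comment> \<open>Such an \<open>x\<close> lies in the spans of both \<open>B0\<close> and
    \<open>C\<close>, which are disjoint parts of one independent set, so all its coordinates
    vanish.\<close>
  have ker: "x = 0" if x: "x \<in> vs1.span C" "f x = 0" for x
  proof -
    have "x \<in> S"
      using x(1) vs1.span_minimal[OF _ S, of C] B1(2) by (auto simp: C_def)
    then have "x \<in> vs1.span B0" using B0(3) x(2) by (auto simp: K_def)
    then have r: "vs1.representation B1 x = vs1.representation B0 x"
      "vs1.representation B1 x = vs1.representation C x"
      using vs1.representation_extend[OF B1(3), of x B0] vs1.representation_extend[OF B1(3), of x C] x(1) Un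
      by blast+
    have "vs1.representation B1 x b = 0" for b
      using vs1.representation_ne_zero[of B0 x b] vs1.representation_ne_zero[of C x b] r disj
      by fastforce
    moreover have "x \<in> vs1.span B1" using x(1) Un vs1.span_mono[of C B1] by blast
    ultimately show "x = 0"
      using vs1.sum_nonzero_representation_eq[OF B1(3), of x] by simp
  qed
  then have inj: "inj_on f (vs1.span C)"
    using f.inj_on_iff_eq_0[OF vs1.subspace_span] by blast
  have "vs1.independent C" using B1(3) Un vs1.independent_mono[of B1 C] by blast
  then have indep: "vs2.independent (f ` C)" using f.independent_injective_image inj by blast
  have "f ` S \<subseteq> vs2.span (f ` C)"
  proof
    fix y assume "y \<in> f ` S"
    then obtain x where x: "x \<in> vs1.span B1" "y = f x" using B1(4) by blast
    have "y \<in> vs2.span (f ` B1)" using x f.span_image by blast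
    moreover have "f ` B1 \<subseteq> insert 0 (f ` C)"
      using B0(1) Un by (auto simp: K_def)
    ultimately show "y \<in> vs2.span (f ` C)"
      using vs2.span_mono vs2.span_insert_0 by blast
  qed
  moreover have "f ` C \<subseteq> f ` S" using B1(2) C_def by blast
  ultimately have "card (f ` C) = vs2.dim (f ` S)"
    using vs2.basis_card_eq_dim[OF _ _ indep] by blast
  moreover have "card (f ` C) = card C"
    using card_image inj_on_subset[OF inj vs1.span_superset] by blast
  moreover have "card B0 = vs1.dim K" "card B1 = vs1.dim S"
    using vs1.basis_card_eq_dim B0 B1 by auto
  moreover have "card B1 = card B0 + card C"
    using Un disj finB1 card_Un_disjoint by (metis finite_Un)
  ultimately show ?thesis by (simp add: K_def)
qed

lemma dim_image_inj_on:
  assumes f: "Vector_Spaces.linear s1 s2 f" and S: "vs1.subspace S" and inj: "\<And>x. x \<in> S \<Longrightarrow> f x = 0 \<Longrightarrow> x = 0"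
  shows "vs2.dim (f ` S) = vs1.dim S"
proof -
  interpret f: Vector_Spaces.linear s1 s2 f by (fact f)
  obtain B where B: "B \<subseteq> S" "vs1.independent B" "S \<subseteq> vs1.span B" "card B = vs1.dim S"
    using vs1.basis_exists by blast
  have sp: "vs1.span B = S" using B S vs1.span_minimal by blast
  then have i: "inj_on f (vs1.span B)"
    using inj S f.inj_on_iff_eq_0 by blast
  have "f ` S = vs2.span (f ` B)" using f.span_image sp by blast
  then have "vs2.dim (f ` S) = card (f ` B)"
    using vs2.dim_span_eq_card_independent f.independent_injective_image[OF B(2) i] by simp
  also have "\<dots> = card B"
    using card_image inj_on_subset[OF i vs1.span_superset] by blast
  finally show ?thesis using B by simp
qed

end

text \<open>An infinite basis has cardinality 0, so monotonicity of \<open>dim\<close> is only safe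
  below a finitely spanned space.\<close>

lemma (in vector_space) dim_mono_finite_span:
  assumes "V \<subseteq> W" "finite B" "W \<subseteq> span B"
  shows "dim V \<le> dim W"
proof -
  obtain C where C: "C \<subseteq> W" "independent C" "W \<subseteq> span C" "card C = dim W"
    using basis_exists by blast
  have "finite C" using independent_span_bound[OF assms(2) C(2)] C(1) assms(3) by blast
  then show ?thesis using dim_le_card[of V C] C assms(1) by auto
qed

section \<open>Polynomials in two variables, filtered by degree and by order at the origin\<close>

text \<open>Dimensions are taken over the field, whereas \<open>smult\<close> on
  \<open>k[y][z]\<close> multiplies by elements of \<open>k[y]\<close>.\<close>

definition cscale :: "'k::field \<Rightarrow> 'k poly poly \<Rightarrow> 'k poly poly" where
  "cscale c f = smult [:c:] f"

global_interpretation up: vector_space "smult :: 'k::field \<Rightarrow> 'k poly \<Rightarrow> 'k poly"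
  by unfold_locales (auto simp: smult_add_right smult_add_left)

global_interpretation bp: vector_space "cscale :: 'k::field \<Rightarrow> 'k poly poly \<Rightarrow> 'k poly poly"
  by unfold_locales (simp_all add: cscale_def poly_eq_iff algebra_simps)

global_interpretation bpup: vector_space_pair
  "cscale :: 'k::field \<Rightarrow> 'k poly poly \<Rightarrow> 'k poly poly" "smult :: 'k \<Rightarrow> 'k poly \<Rightarrow> 'k poly" ..

global_interpretation bpbp: vector_space_pair
  "cscale :: 'k::field \<Rightarrow> 'k poly poly \<Rightarrow> 'k poly poly" cscale ..

text \<open>A polynomial \<open>f\<close> in \<open>k[y][z]\<close> stands for \<open>\<Sum> bcoeff f i j * z^i * y^j\<close>.\<close>

definition bcoeff :: "'k::field poly poly \<Rightarrow> nat \<Rightarrow> nat \<Rightarrow> 'k" where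
  "bcoeff f i j = coeff (coeff f i) j"

lemma bcoeff_eqI: "(\<And>i j. bcoeff f i j = bcoeff g i j) \<Longrightarrow> f = g"
  by (auto simp: bcoeff_def poly_eq_iff)

lemma bcoeff_simps [simp]:
  "bcoeff 0 i j = 0"
  "bcoeff (f + g) i j = bcoeff f i j + bcoeff g i j"
  "bcoeff (f - g) i j = bcoeff f i j - bcoeff g i j"
  "bcoeff (cscale c f) i j = c * bcoeff f i j"
  "bcoeff (sum h A) i j = (\<Sum>x\<in>A. bcoeff (h x) i j)"
  "bcoeff (monom (monom c b) a) i j = (if i = a \<and> j = b then c else 0)"
  by (auto simp: bcoeff_def cscale_def coeff_sum)

lemma bcoeff_linear_mult:
  "bcoeff ([:-[:c, l:], 1:] * f) i j =
     (if i = 0 then 0 else bcoeff f (i - 1) j) - c * bcoeff f i j - (if j = 0 then 0 else l * bcoeff f i (j - 1))"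
  by (cases i; cases j) (auto simp: bcoeff_def)

text \<open>With the strict bound, a restriction to a line has exactly \<open>d\<close>
  coefficients, \<open>deg_less 0\<close> is the zero space, and the dimension of
  \<open>deg_less n\<close> is the number of conditions imposed by a point of multiplicity
  \<open>n\<close>.\<close>

definition deg_less :: "nat \<Rightarrow> 'k::field poly poly set" where
  "deg_less d = {f. \<forall>i j. d \<le> i + j \<longrightarrow> bcoeff f i j = 0}"

definition ord_ge :: "nat \<Rightarrow> 'k::field poly poly set" where
  "ord_ge m = {f. \<forall>i j. i + j < m \<longrightarrow> bcoeff f i j = 0}"

lemma subspace_deg_less: "bp.subspace (deg_less d)"
  by (auto simp: bp.subspace_def deg_less_def)

lemma subspace_ord_ge: "bp.subspace (ord_ge m)"
  by (auto simp: bp.subspace_def ord_ge_def)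

definition monoms :: "nat \<Rightarrow> 'k::field poly poly set" where
  "monoms d = (\<lambda>(i, j). monom (monom 1 j) i) ` ({..<d} \<times> {..<d})"

lemma finite_monoms: "finite (monoms d)"
  by (simp add: monoms_def)

lemma deg_less_span: "deg_less d \<subseteq> bp.span (monoms d)"
proof
  fix f :: "'a poly poly" assume f: "f \<in> deg_less d"
  have "f = (\<Sum>i<d. \<Sum>j<d. cscale (bcoeff f i j) (monom (monom 1 j) i))"
  proof (rule bcoeff_eqI)
    fix i j
    have "(\<Sum>i'<d. \<Sum>j'<d. bcoeff f i' j' * (if i = i' \<and> j = j' then 1 else 0))
        = (\<Sum>i'<d. if i' = i then \<Sum>j'<d. if j' = j then bcoeff f i j else 0 else 0)"
      by (intro sum.cong refl) (auto simp: if_distrib[of "(*) _"] cong: if_cong)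
    also have "\<dots> = (if i < d \<and> j < d then bcoeff f i j else 0)" by simp
    also have "\<dots> = bcoeff f i j" using f by (auto simp: deg_less_def)
    finally show "bcoeff f i j = bcoeff (\<Sum>i<d. \<Sum>j<d. cscale (bcoeff f i j) (monom (monom 1 j) i)) i j"
      by simp
  qed
  also have "\<dots> \<in> bp.span (monoms d)"
    by (intro bp.span_sum bp.span_scale bp.span_base) (auto simp: monoms_def)
  finally show "f \<in> bp.span (monoms d)" .
qed

lemma subset_deg_less_span: "S \<subseteq> deg_less d \<Longrightarrow> S \<subseteq> bp.span (monoms d)"
  using deg_less_span by blast

text \<open>The cofactor of \<open>Q\<close> has degree below \<open>d - degree Q\<close>. If
  \<open>degree Q\<close> is at least \<open>d\<close>, only 0 qualifies, in agreement with
  truncated subtraction.\<close>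

lemma dim_deg_less_poly_le:
  fixes Q :: "'k::field poly"
  assumes "Q \<noteq> 0"
  shows "up.dim {g. (\<forall>i\<ge>d. coeff g i = 0) \<and> Q dvd g} \<le> d - degree Q"
proof -
  let ?B = "(\<lambda>i. Q * monom 1 i) ` {..<d - degree Q}"
  have "{g. (\<forall>i\<ge>d. coeff g i = 0) \<and> Q dvd g} \<subseteq> up.span ?B"
  proof
    fix g assume "g \<in> {g. (\<forall>i\<ge>d. coeff g i = 0) \<and> Q dvd g}"
    then obtain h where g: "g = Q * h" and c: "\<forall>i\<ge>d. coeff g i = 0" by (auto elim: dvdE)
    have h: "coeff h i = 0" if "i \<ge> d - degree Q" for i
    proof (cases "h = 0")
      case False
      have "degree g < d"
        using c False g assms leading_coeff_neq_0[of g] by (metis mult_eq_0_iff not_le)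
      then have "degree h < i" using that False g assms degree_mult_eq[of Q h] by simp
      then show ?thesis by (rule coeff_eq_0)
    qed simp
    have "h = (\<Sum>i<d - degree Q. smult (coeff h i) (monom 1 i))"
      by (rule poly_eqI) (auto simp: coeff_sum h smult_monom)
    then have "g = (\<Sum>i<d - degree Q. smult (coeff h i) (Q * monom 1 i))"
      using g by (metis (no_types, lifting) mult_smult_right sum.cong sum_distrib_left)
    then show "g \<in> up.span ?B"
      by (metis (no_types, lifting) imageI up.span_base up.span_scale up.span_sum)
  qed
  then have "up.dim {g. (\<forall>i\<ge>d. coeff g i = 0) \<and> Q dvd g} \<le> card ?B"
    by (intro up.dim_le_card) auto
  also have "\<dots> \<le> d - degree Q" using card_image_le[of "{..<d - degree Q}"] by simp
  finally show ?thesis .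
qed

lemma linear_mult_left: "Vector_Spaces.linear cscale cscale (\<lambda>g. (h :: 'k::field poly poly) * g)"
  by (simp add: Vector_Spaces.linear_iff bp.vector_space_axioms cscale_def algebra_simps)

lemma dim_image_mult_left: "h \<noteq> 0 \<Longrightarrow> bp.subspace S \<Longrightarrow> bp.dim ((\<lambda>g. h * g) ` S) = bp.dim S"
  by (rule bpbp.dim_image_inj_on[OF linear_mult_left]) auto

lemma linear_restrict: "Vector_Spaces.linear cscale smult (\<lambda>f :: 'k::field poly poly. poly f q)"
  by (simp add: Vector_Spaces.linear_iff bp.vector_space_axioms up.vector_space_axioms cscale_def)


lemma dim_Collect_coeff_zero: "up.dim {g :: 'k::field poly. \<forall>i\<ge>d. coeff g i = 0} = d"
proof -
  let ?B = "(\<lambda>i. monom 1 i :: 'k poly) ` {..<d}"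
  have ind: "up.independent ?B"
  proof (rule up.independent_if_scalars_zero)
    fix c :: "'k poly \<Rightarrow> 'k" and g
    assume z: "(\<Sum>g\<in>?B. smult (c g) g) = 0" and g: "g \<in> ?B"
    have inj: "inj_on (\<lambda>i. monom 1 i :: 'k poly) {..<d}"
      by (auto simp: inj_on_def monom_eq_iff')
    from g obtain j where j: "j < d" "g = monom 1 j" by blast
    have "coeff (\<Sum>i<d. smult (c (monom 1 i)) (monom 1 i)) j = c g"
      using j by (simp add: coeff_sum if_distrib cong: if_cong)
    then show "c g = 0" using z by (simp add: sum.reindex[OF inj])
  qed simp
  have "up.dim {g :: 'k poly. \<forall>i\<ge>d. coeff g i = 0} = card ?B"
  proof (rule up.dim_unique[OF _ _ ind refl])
    show "{g :: 'k poly. \<forall>i\<ge>d. coeff g i = 0} \<subseteq> up.span ?B"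
    proof
      fix g :: "'k poly" assume g: "g \<in> {g. \<forall>i\<ge>d. coeff g i = 0}"
      have "g = (\<Sum>i<d. smult (coeff g i) (monom 1 i))"
        using g by (auto intro!: poly_eqI simp: coeff_sum smult_monom)
      also have "\<dots> \<in> up.span ?B" by (intro up.span_sum up.span_scale up.span_base) auto
      finally show "g \<in> up.span ?B" .
    qed
  qed auto
  also have "\<dots> = d" by (subst card_image) (auto simp: inj_on_def monom_eq_iff')
  finally show ?thesis .
qed

lemma pCons_0_deg_less: "pCons 0 g \<in> deg_less (Suc d) \<longleftrightarrow> g \<in> deg_less d"
proof
  assume *: "pCons 0 g \<in> deg_less (Suc d)"
  show "g \<in> deg_less d" unfolding deg_less_def
  proof safe
    fix i j assume "d \<le> i + j"
    then have "bcoeff (pCons 0 g) (Suc i) j = 0" using * unfolding deg_less_def by simp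
    then show "bcoeff g i j = 0" by (simp add: bcoeff_def)
  qed
next
  assume *: "g \<in> deg_less d"
  show "pCons 0 g \<in> deg_less (Suc d)" unfolding deg_less_def
  proof safe
    fix i j assume "Suc d \<le> i + j"
    then show "bcoeff (pCons 0 g) i j = 0" using * unfolding deg_less_def bcoeff_def
      by (cases i) auto
  qed
qed

text \<open>Induction by setting z = 0: the kernel is z times \<open>deg_less d\<close>, and the
  image consists of all polynomials in y with \<open>Suc d\<close> coefficients.\<close>

lemma dim_deg_less: "2 * bp.dim (deg_less d :: 'k::field poly poly set) = d * (d + 1)"
proof (induction d)
  case 0
  have "(deg_less 0 :: 'k poly poly set) = {0}"
    by (auto simp: deg_less_def intro: bcoeff_eqI)
  then show ?case using bp.span_eq_dim[of "{0 :: 'k poly poly}" "{}"] bp.dim_eq_card_independent[OF bp.independent_empty]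
    by (simp add: bp.span_insert_0)
next
  case (Suc d)
  let ?S = "deg_less (Suc d) :: 'k poly poly set"
  have "{f \<in> ?S. poly f 0 = 0} = (\<lambda>g. [:0, 1:] * g) ` deg_less d"
  proof (intro equalityI subsetI)
    fix f assume f: "f \<in> {f \<in> ?S. poly f 0 = 0}"
    then obtain g where "f = pCons 0 g" by (cases f) auto
    then show "f \<in> (\<lambda>g. [:0, 1:] * g) ` deg_less d"
      using f pCons_0_deg_less[of g d] by (auto intro!: image_eqI[of _ _ g])
  qed (auto simp: pCons_0_deg_less)
  then have ker: "bp.dim {f \<in> ?S. poly f 0 = 0} = bp.dim (deg_less d :: 'k poly poly set)"
    using dim_image_mult_left[OF _ subspace_deg_less, of "[:0, 1:]"] by simp
  have img: "(\<lambda>f. poly f 0) ` ?S = {g. \<forall>i\<ge>Suc d. coeff g i = 0}"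
  proof (intro equalityI subsetI)
    fix g :: "'k poly" assume g: "g \<in> {g. \<forall>i\<ge>Suc d. coeff g i = 0}"
    then have "[:g:] \<in> ?S" by (auto simp: deg_less_def bcoeff_def coeff_pCons split: nat.split)
    then show "g \<in> (\<lambda>f. poly f 0) ` ?S" by (auto intro!: image_eqI[of _ _ "[:g:]"])
  next
    fix g assume "g \<in> (\<lambda>f. poly f 0) ` ?S"
    then obtain f where f: "f \<in> ?S" "g = poly f 0" by blast
    then have "coeff g i = bcoeff f 0 i" for i by (simp add: bcoeff_def poly_0_coeff_0)
    then show "g \<in> {g. \<forall>i\<ge>Suc d. coeff g i = 0}" using f by (simp add: deg_less_def)
  qed
  have "bp.dim ?S = bp.dim {f \<in> ?S. poly f 0 = 0} + up.dim ((\<lambda>f. poly f 0) ` ?S)"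
    by (rule bpup.rank_nullity_on[OF linear_restrict subspace_deg_less finite_monoms deg_less_span])
  also have "\<dots> = bp.dim (deg_less d :: 'k poly poly set) + Suc d"
    unfolding ker img dim_Collect_coeff_zero ..
  finally have "bp.dim ?S = bp.dim (deg_less d :: 'k poly poly set) + Suc d" .
  then show ?case using Suc by simp
qed

section \<open>Translation, restriction to a line, and multiplication by the equation of a
  line\<close>

text \<open>The substitution of y + a for y and z + b for z: the coefficients of
  \<open>shift a b f\<close> are the Taylor coefficients of \<open>f\<close> at y = a, z =
  b.\<close>

definition shift :: "'k::field \<Rightarrow> 'k \<Rightarrow> 'k poly poly \<Rightarrow> 'k poly poly" where
  "shift a b f = pcompose (map_poly (\<lambda>c. pcompose c [:a, 1:]) f) [:[:b:], 1:]"

lemma map_poly_pcompose_add: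
  "map_poly (\<lambda>c. pcompose c q) (f + g) = map_poly (\<lambda>c. pcompose c q) f + map_poly (\<lambda>c. pcompose c q) g"
  by (rule poly_eqI) (simp add: coeff_map_poly pcompose_add)

lemma map_poly_pcompose_mult:
  "map_poly (\<lambda>c. pcompose c (q :: 'k::field poly)) (f * g) = map_poly (\<lambda>c. pcompose c q) f * map_poly (\<lambda>c. pcompose c q) g"
  by (rule poly_eqI) (simp add: coeff_map_poly coeff_mult pcompose_sum pcompose_mult)

lemma shift_add: "shift a b (f + g) = shift a b f + shift a b g"
  by (simp add: shift_def map_poly_pcompose_add pcompose_add)

lemma shift_mult: "shift a b (f * g) = shift a b f * shift a b g"
  by (simp add: shift_def map_poly_pcompose_mult pcompose_mult)

lemma map_poly_pCons_pcompose:
  "map_poly (\<lambda>c. pcompose c q) (pCons x f) = pCons (pcompose x q) (map_poly (\<lambda>c. pcompose c (q :: 'k::field poly)) f)"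
  by (rule poly_eqI) (simp add: coeff_map_poly coeff_pCons split: nat.split)

lemma shift_const [simp]: "shift a b [:[:c:]:] = [:[:c:]:]"
  by (simp add: shift_def map_poly_pCons_pcompose)

lemma shift_0 [simp]: "shift a b 0 = 0"
  by (simp add: shift_def)

text \<open>\<open>[:-[:c, l:], 1:]\<close> is z - (c + l y), the equation of a non-vertical line;
  evaluating a polynomial at \<open>[:c, l:]\<close> is restriction to that line, with parameter y.
  The new constant term is zero exactly when the line passes through (a, b).\<close>

lemma shift_line: "shift a b [:-[:c, l:], 1:] = [:-[:c + l * a - b, l:], 1:]"
  by (simp add: shift_def map_poly_pCons_pcompose pcompose_pCons one_pCons)

lemma shift_cscale: "shift a b (cscale c f) = cscale c (shift a b f)"
  using shift_mult[of a b "[:[:c:]:]" f] by (simp add: cscale_def)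

lemma linear_shift: "Vector_Spaces.linear cscale cscale (shift a b)"
  by (simp add: Vector_Spaces.linear_iff bp.vector_space_axioms shift_add shift_cscale)

lemma poly_map_poly_pcompose:
  "pcompose (poly f x) q = poly (map_poly (\<lambda>c. pcompose c q) f) (pcompose x (q :: 'k::field poly))"
  by (induction f) (simp_all add: map_poly_pCons_pcompose pcompose_add pcompose_mult)

lemma poly_pcompose_line:
  assumes "b = c + l * a"
  shows "pcompose (poly f [:c, l:]) [:a, 1:] = poly (shift a b f) [:0, l:]"
  using assms by (simp add: shift_def poly_pcompose poly_map_poly_pcompose pcompose_pCons algebra_simps)

text \<open>On the line z = l y each monomial \<open>z^i * y^j\<close> turns into a multiple of
  \<open>y^(i + j)\<close>.\<close>

lemma ord_ge_restrict_line:
  assumes "g \<in> ord_ge m"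
  shows "[:0, 1:] ^ m dvd poly g [:0, l:]"
proof -
  have "[:0, 1:] ^ m dvd coeff g i * [:0, l:] ^ i" for i
  proof -
    have "monom 1 (m - i) dvd coeff g i"
      using assms by (auto simp: monom_1_dvd_iff' ord_ge_def bcoeff_def)
    moreover have "[:0, l:] ^ i = monom 1 i * [:l ^ i:]"
      by (induction i) (simp_all add: monom_altdef one_pCons algebra_simps)
    ultimately have "monom 1 (m - i) * monom 1 i dvd coeff g i * [:0, l:] ^ i"
      by (metis dvd_triv_left mult_dvd_mono)
    moreover have "monom (1::'a) (m - i) * monom 1 i = [:0, 1:] ^ m * monom 1 (m - i + i - m)"
      by (simp add: mult_monom monom_altdef flip: power_add)
    ultimately show ?thesis by (metis dvd_mult_left)
  qed
  then show ?thesis by (simp add: poly_altdef dvd_sum)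
qed

lemma pcompose_power: "pcompose (p ^ n) (q :: 'k::field poly) = pcompose p q ^ n"
  by (induction n) (simp_all add: pcompose_mult pcompose_1)

lemma vanish_restrict_line:
  assumes "shift a b f \<in> ord_ge m" "b = c + l * a"
  shows "[:-a, 1:] ^ m dvd poly f [:c, l:]"
proof -
  obtain h where h: "pcompose (poly f [:c, l:]) [:a, 1:] = [:0, 1:] ^ m * h"
    using ord_ge_restrict_line[OF assms(1)] poly_pcompose_line[OF assms(2), of f] by (metis dvdE)
  have "poly f [:c, l:] = pcompose (pcompose (poly f [:c, l:]) [:a, 1:]) [:-a, 1:]"
    by (simp add: pcompose_pCons pcompose_idR flip: pcompose_assoc)
  also have "\<dots> = [:-a, 1:] ^ m * pcompose h [:-a, 1:]"
    by (simp add: h pcompose_mult pcompose_power pcompose_pCons)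
  finally show ?thesis by simp
qed


lemma line_mult_deg_less_iff:
  "[:-[:c, l:], 1:] * g \<in> deg_less d \<longleftrightarrow> g \<in> deg_less (d - 1)"
proof (cases d)
  case 0
  have "f \<in> deg_less 0 \<longleftrightarrow> f = 0" for f :: "'a poly poly"
    by (auto simp: deg_less_def intro: bcoeff_eqI)
  then show ?thesis using 0 by (simp del: mult_pCons_left)
next
  case (Suc e)
  let ?f = "[:-[:c, l:], 1:] * g"
  show ?thesis
  proof
    assume f: "?f \<in> deg_less d"
    \<comment> \<open>Downward induction on the exponent of z, \<open>k\<close> being its distance
      from \<open>Suc (degree g)\<close>: in the coefficient of the product at (i + 1, j), the other
      terms involve only coefficients of \<open>g\<close> in row i + 1, which already
      vanish.\<close>
    have *: "e \<le> i + j \<longrightarrow> bcoeff g i j = 0" if "Suc (degree g) = i + k" for i j k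
      using that
    proof (induction k arbitrary: i j)
      case 0
      then show ?case by (simp add: bcoeff_def coeff_eq_0)
    next
      case (Suc k)
      show ?case
      proof
        assume ij: "e \<le> i + j"
        have "bcoeff ?f (Suc i) j = 0" using f ij \<open>d = Suc e\<close> by (simp add: deg_less_def)
        moreover have "bcoeff g (Suc i) j = 0" "j \<noteq> 0 \<Longrightarrow> bcoeff g (Suc i) (j - 1) = 0"
          using Suc.IH[of "Suc i"] Suc.prems ij by auto
        ultimately show "bcoeff g i j = 0"
          unfolding bcoeff_linear_mult by (auto split: if_splits)
      qed
    qed
    have small: "e \<le> i + j \<Longrightarrow> i \<le> degree g \<Longrightarrow> bcoeff g i j = 0" for i j
    proof -
      assume ij: "e \<le> i + j" "i \<le> degree g"
      show "bcoeff g i j = 0" using * [of i "Suc (degree g) - i" j] ij by simp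
    qed
    have big: "bcoeff g i j = 0" if "i > degree g" for i j
      using that by (simp add: bcoeff_def coeff_eq_0)
    show "g \<in> deg_less (d - 1)"
      unfolding deg_less_def mem_Collect_eq using Suc
    proof (intro allI impI)
      fix i j assume "d - 1 \<le> i + j"
      then show "bcoeff g i j = 0" using small[of i j] big[of i j] Suc by (cases "i \<le> degree g") auto
    qed
  next
    assume g: "g \<in> deg_less (d - 1)"
    show "?f \<in> deg_less d"
      using g Suc unfolding deg_less_def mem_Collect_eq bcoeff_linear_mult by auto
  qed
qed

text \<open>If \<open>e\<close> is nonzero, the line misses the origin and its equation has
  invertible constant term, so coefficients of \<open>g\<close> are eliminated by increasing total
  degree. If \<open>e = 0\<close>, the coefficient of the product at (i + 1, j) is that of
  \<open>g\<close> at (i, j) minus \<open>l\<close> times the one at (i + 1, j - 1), which allows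
  induction on \<open>j\<close>.\<close>

lemma line_mult_ord_ge_iff:
  "[:-[:e, l:], 1:] * g \<in> ord_ge m \<longleftrightarrow> g \<in> ord_ge (m - of_bool (e = 0))"
proof
  let ?f = "[:-[:e, l:], 1:] * g"
  show "?f \<in> ord_ge m" if "g \<in> ord_ge (m - of_bool (e = 0))"
    using that unfolding ord_ge_def mem_Collect_eq bcoeff_linear_mult by (auto simp: of_bool_def split: if_splits)
  assume f: "?f \<in> ord_ge m"
  show "g \<in> ord_ge (m - of_bool (e = 0))"
  proof (cases "e = 0")
    case True
    have "Suc (i + j) < m \<longrightarrow> bcoeff g i j = 0" for i j
    proof (induction j arbitrary: i)
      case 0
      have "Suc i < m \<Longrightarrow> bcoeff ?f (Suc i) 0 = 0" using f by (simp add: ord_ge_def del: mult_pCons_left)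
      then show ?case unfolding bcoeff_linear_mult using True by simp
    next
      case (Suc j)
      have "Suc (i + Suc j) < m \<Longrightarrow> bcoeff ?f (Suc i) (Suc j) = 0" using f by (simp add: ord_ge_def del: mult_pCons_left)
      then show ?case unfolding bcoeff_linear_mult using True Suc[of "Suc i"] by simp
    qed
    then show ?thesis using True by (auto simp: ord_ge_def)
  next
    case False
    have "i + j = k \<Longrightarrow> k < m \<Longrightarrow> bcoeff g i j = 0" for i j k
    proof (induction k arbitrary: i j rule: less_induct)
      case (less k)
      have "bcoeff ?f i j = 0" using f less.prems by (simp add: ord_ge_def del: mult_pCons_left)
      moreover have "i \<noteq> 0 \<Longrightarrow> bcoeff g (i - 1) j = 0" "j \<noteq> 0 \<Longrightarrow> bcoeff g i (j - 1) = 0"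
        using less.IH[of "k - 1" "i - 1" j] less.IH[of "k - 1" i "j - 1"] less.prems by auto
      ultimately show ?case unfolding bcoeff_linear_mult using False by (auto split: if_splits)
    qed
    then show ?thesis using False by (auto simp: ord_ge_def)
  qed
qed

section \<open>Spaces with prescribed multiplicities and their defect\<close>

definition vanishing :: "'p set \<Rightarrow> ('p \<Rightarrow> 'k::field) \<Rightarrow> ('p \<Rightarrow> 'k) \<Rightarrow> ('p \<Rightarrow> nat) \<Rightarrow> nat \<Rightarrow> 'k poly poly set" where
  "vanishing X a b n d = {f \<in> deg_less d. \<forall>p\<in>X. shift (a p) (b p) f \<in> ord_ge (n p)}"

lemma vanishing_subset_deg_less: "vanishing X a b n d \<subseteq> deg_less d"
  by (auto simp: vanishing_def)

lemma subspace_vanishing: "bp.subspace (vanishing X a b n d)"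
  using subspace_deg_less[of d] subspace_ord_ge
  unfolding vanishing_def bp.subspace_def by (auto simp: shift_add shift_cscale)

lemma vanishing_line_mult:
  "[:-[:c, l:], 1:] * g \<in> vanishing X a b n d \<longleftrightarrow>
     g \<in> vanishing X a b (\<lambda>p. n p - of_bool (b p = c + l * a p)) (d - 1)"
proof -
  have "c + l * a p - b p = 0 \<longleftrightarrow> b p = c + l * a p" for p by auto
  then show ?thesis
    unfolding vanishing_def mem_Collect_eq line_mult_deg_less_iff shift_mult shift_line line_mult_ord_ge_iff
    by simp
qed

lemma prime_elem_linear: "prime_elem [:-a, 1 :: 'k::field:]"
proof (rule prime_elemI)
  show "\<not> [:-a, 1:] dvd 1" by (simp add: is_unit_poly_iff)
  fix p q assume "[:-a, 1:] dvd p * q"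
  then show "[:-a, 1:] dvd p \<or> [:-a, 1:] dvd q" by (simp flip: poly_eq_0_iff_dvd)
qed simp

lemma prod_linear_power_dvd:
  fixes g :: "'k::field poly"
  assumes "finite A" "inj_on a A" "\<And>p. p \<in> A \<Longrightarrow> [:-a p, 1:] ^ n p dvd g"
  shows "(\<Prod>p\<in>A. [:-a p, 1:] ^ n p) dvd g"
  using assms
proof (induction A)
  case (insert p A)
  let ?Q = "\<Prod>p\<in>A. [:-a p, 1:] ^ n p"
  obtain h where h: "g = ?Q * h" using insert by (auto elim: dvdE)
  have "poly ?Q (a p) \<noteq> 0"
    using insert by (auto simp: poly_prod)
  then have "\<not> [:-a p, 1:] dvd ?Q" by (simp add: poly_eq_0_iff_dvd)
  moreover have "[:-a p, 1:] ^ n p dvd ?Q * h" using insert.prems(2) h by auto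
  ultimately have "[:-a p, 1:] ^ n p dvd h"
    using prime_power_dvd_multD[OF prime_elem_linear, of "a p" "n p" ?Q h] by (cases "n p = 0") auto
  then have "[:-a p, 1:] ^ n p * ?Q dvd h * ?Q" by (rule mult_dvd_mono) simp
  then show ?case using insert.hyps h by (simp add: mult.commute)
qed simp

lemma degree_prod_linear_power:
  "finite A \<Longrightarrow> degree (\<Prod>p\<in>A. [:-a p, 1 :: 'k::field:] ^ n p) = (\<Sum>p\<in>A. n p)"
  by (subst degree_prod_eq_sum_degree) (auto simp: degree_power_eq)

lemma deg_less_restrict_line:
  assumes "f \<in> deg_less d" "d \<le> k"
  shows "coeff (poly f [:c, l:]) k = 0"
proof -
  have "coeff (coeff f i * [:c, l:] ^ i) k = 0" for i
  proof (cases "coeff f i = 0")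
    case False
    then have "bcoeff f i (degree (coeff f i)) \<noteq> 0" by (simp add: bcoeff_def)
    then have "\<not> d \<le> i + degree (coeff f i)" using assms(1) by (auto simp: deg_less_def)
    moreover have "degree ([:c, l:] ^ i) \<le> 1 * i"
      by (rule order_trans[OF degree_power_le]) simp
    moreover have "degree (coeff f i * [:c, l:] ^ i) \<le> degree (coeff f i) + degree ([:c, l:] ^ i)"
      by (rule degree_mult_le)
    ultimately show ?thesis using assms(2) by (intro coeff_eq_0) linarith
  qed simp
  then show ?thesis by (simp add: poly_altdef coeff_sum)
qed

text \<open>Rank-nullity for restriction to the line. The kernel is the equation of the line times
  the space with reduced multiplicities. The image lies in the polynomials with \<open>d\<close>
  coefficients that are divisible by the product \<open>?Q\<close>, whose degree is the sum of the
  multiplicities on the line. Once that sum reaches \<open>d\<close>, the truncated difference is 0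
  and the two bounds coincide.\<close>

lemma dim_vanishing_step:
  fixes a b :: "'p \<Rightarrow> 'k::field" and n :: "'p \<Rightarrow> nat" and c l :: 'k
  assumes fin: "finite X" and inj: "inj_on (\<lambda>p. (a p, b p)) X"
  defines "n' \<equiv> \<lambda>p. n p - of_bool (b p = c + l * a p)"
  shows "bp.dim (vanishing X a b n' (d - 1)) \<le> bp.dim (vanishing X a b n d)"
    and "bp.dim (vanishing X a b n d)
      \<le> bp.dim (vanishing X a b n' (d - 1)) + (d - (\<Sum>p\<in>{p\<in>X. b p = c + l * a p}. n p))"
proof -
  let ?V = "vanishing X a b n d" and ?A = "{p\<in>X. b p = c + l * a p}"
  let ?Q = "\<Prod>p\<in>?A. [:-a p, 1:] ^ n p" and ?h = "[:-[:c, l:], 1:]"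
  have "{f \<in> ?V. poly f [:c, l:] = 0} = (\<lambda>g. ?h * g) ` vanishing X a b n' (d - 1)"
    unfolding n'_def
  proof (intro equalityI subsetI)
    fix f assume f: "f \<in> {f \<in> ?V. poly f [:c, l:] = 0}"
    then obtain g where "f = ?h * g" by (auto simp: poly_eq_0_iff_dvd elim: dvdE)
    then show "f \<in> (\<lambda>g. ?h * g) ` vanishing X a b (\<lambda>p. n p - of_bool (b p = c + l * a p)) (d - 1)"
      using f vanishing_line_mult[of c l g X a b n d] by blast
  next
    fix f assume "f \<in> (\<lambda>g. ?h * g) ` vanishing X a b (\<lambda>p. n p - of_bool (b p = c + l * a p)) (d - 1)"
    then show "f \<in> {f \<in> ?V. poly f [:c, l:] = 0}"
      using vanishing_line_mult[of c l _ X a b n d] by (auto simp del: mult_pCons_left)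
  qed
  then have ker: "bp.dim {f \<in> ?V. poly f [:c, l:] = 0} = bp.dim (vanishing X a b n' (d - 1))"
    using dim_image_mult_left[OF _ subspace_vanishing, of ?h] by (simp del: mult_pCons_left)
  have eq: "bp.dim ?V = bp.dim (vanishing X a b n' (d - 1)) + up.dim ((\<lambda>f. poly f [:c, l:]) ` ?V)"
    unfolding ker[symmetric]
    by (rule bpup.rank_nullity_on[OF linear_restrict subspace_vanishing finite_monoms
        subset_deg_less_span[OF vanishing_subset_deg_less]])
  then show "bp.dim (vanishing X a b n' (d - 1)) \<le> bp.dim ?V" by simp
  \<comment> \<open>On a non-vertical line the coordinate y alone separates points, so the linear
    factors of \<open>?Q\<close> belong to distinct roots.\<close>
  have "inj_on a ?A"
  proof (rule inj_onI)
    fix p q assume "p \<in> ?A" "q \<in> ?A" "a p = a q"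
    then show "p = q" using inj_onD[OF inj, of p q] by auto
  qed
  then have "?Q dvd poly f [:c, l:]" if "f \<in> ?V" for f
    using that fin by (intro prod_linear_power_dvd vanish_restrict_line) (auto simp: vanishing_def)
  then have "(\<lambda>f. poly f [:c, l:]) ` ?V \<subseteq> {g. (\<forall>i\<ge>d. coeff g i = 0) \<and> ?Q dvd g}" (is "_ \<subseteq> ?G")
    using deg_less_restrict_line vanishing_subset_deg_less by blast
  moreover have "?G \<subseteq> up.span ((\<lambda>i. monom 1 i) ` {..<d})"
  proof
    fix g assume "g \<in> ?G"
    then have "g = (\<Sum>i<d. smult (coeff g i) (monom 1 i))"
      by (auto intro!: poly_eqI simp: coeff_sum smult_monom)
    also have "\<dots> \<in> up.span ((\<lambda>i. monom 1 i) ` {..<d})"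
      by (intro up.span_sum up.span_scale up.span_base) auto
    finally show "g \<in> up.span ((\<lambda>i. monom 1 i) ` {..<d})" .
  qed
  ultimately have "up.dim ((\<lambda>f. poly f [:c, l:]) ` ?V) \<le> up.dim ?G"
    by (intro up.dim_mono_finite_span) auto
  also have "\<dots> \<le> d - degree ?Q" by (rule dim_deg_less_poly_le) (use fin in auto)
  also have "degree ?Q = (\<Sum>p\<in>?A. n p)" using fin by (simp add: degree_prod_linear_power)
  finally show "bp.dim ?V \<le> bp.dim (vanishing X a b n' (d - 1)) + (d - (\<Sum>p\<in>?A. n p))"
    using eq by simp
qed

definition truncate :: "nat \<Rightarrow> 'k::field poly poly \<Rightarrow> 'k poly poly" where
  "truncate m f = (\<Sum>i<m. monom (poly_cutoff (m - i) (coeff f i)) i)"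

lemma bcoeff_truncate: "bcoeff (truncate m f) i j = (if i + j < m then bcoeff f i j else 0)"
  by (auto simp: truncate_def bcoeff_def coeff_sum coeff_poly_cutoff if_distrib[of "\<lambda>p. coeff p _"] cong: if_cong)

lemma linear_truncate_shift: "Vector_Spaces.linear cscale cscale (\<lambda>f. truncate m (shift a b f))"
proof -
  interpret sh: Vector_Spaces.linear cscale cscale "shift a b" by (rule linear_shift)
  show ?thesis
    by (auto simp: Vector_Spaces.linear_iff bp.vector_space_axioms sh.add sh.scale bcoeff_truncate intro!: bcoeff_eqI)
qed

text \<open>Points are added one at a time. The Taylor part of order below \<open>n p\<close> is a
  linear map into \<open>deg_less (n p)\<close> whose kernel consists of the polynomials with the
  required multiplicity at \<open>p\<close>.\<close>

lemma dim_vanishing_ge: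
  fixes a b :: "'p \<Rightarrow> 'k::field"
  assumes "finite X"
  shows "bp.dim (deg_less d :: 'k poly poly set)
    \<le> bp.dim (vanishing X a b n d) + (\<Sum>p\<in>X. bp.dim (deg_less (n p) :: 'k poly poly set))"
  using assms
proof induction
  case empty
  show ?case by (simp add: vanishing_def)
next
  case (insert p X)
  let ?V = "vanishing X a b n d" and ?T = "\<lambda>f. truncate (n p) (shift (a p) (b p) f)"
  have "{f \<in> ?V. ?T f = 0} = vanishing (insert p X) a b n d"
  proof -
    have "truncate (n p) f = 0 \<longleftrightarrow> f \<in> ord_ge (n p)" for f :: "'k poly poly"
    proof
      assume "truncate (n p) f = 0"
      then have "bcoeff (truncate (n p) f) i j = 0" for i j by simp
      then show "f \<in> ord_ge (n p)" unfolding ord_ge_def bcoeff_truncate mem_Collect_eq by presburger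
    qed (auto simp: ord_ge_def bcoeff_truncate intro!: bcoeff_eqI)
    then show ?thesis by (auto simp: vanishing_def)
  qed
  then have ker: "vanishing (insert p X) a b n d = {f \<in> ?V. ?T f = 0}" by (rule sym)
  have "bp.dim ?V = bp.dim (vanishing (insert p X) a b n d) + bp.dim (?T ` ?V)"
    unfolding ker
    by (rule bpbp.rank_nullity_on[OF linear_truncate_shift subspace_vanishing finite_monoms
        subset_deg_less_span[OF vanishing_subset_deg_less]])
  moreover have "?T ` ?V \<subseteq> deg_less (n p)"
    by (auto simp: deg_less_def bcoeff_truncate)
  then have "bp.dim (?T ` ?V) \<le> bp.dim (deg_less (n p) :: 'k poly poly set)"
    by (rule bp.dim_mono_finite_span[OF _ finite_monoms deg_less_span])
  ultimately show ?case using insert by simp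
qed

definition defect :: "'p set \<Rightarrow> ('p \<Rightarrow> 'k::field) \<Rightarrow> ('p \<Rightarrow> 'k) \<Rightarrow> ('p \<Rightarrow> nat) \<Rightarrow> nat \<Rightarrow> int" where
  "defect X a b n d = int (bp.dim (vanishing X a b n d)) - int (bp.dim (deg_less d :: 'k poly poly set))
     + (\<Sum>p\<in>X. int (bp.dim (deg_less (n p) :: 'k poly poly set)))"

lemma defect_nonneg: "finite X \<Longrightarrow> 0 \<le> defect X a b n d"
  using dim_vanishing_ge[of X d a b n] by (simp add: defect_def flip: of_nat_sum)

lemma defect_zero:
  assumes "\<And>p. p \<in> X \<Longrightarrow> n p = 0"
  shows "defect X a b n d = 0"
proof -
  have "bp.dim (deg_less 0 :: 'b poly poly set) = 0" using dim_deg_less[of 0] by simp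
  moreover have "vanishing X a b n d = deg_less d"
    using assms by (auto simp: vanishing_def ord_ge_def)
  ultimately show ?thesis using assms by (simp add: defect_def)
qed

lemma dim_deg_less_Suc:
  "bp.dim (deg_less (Suc d) :: 'k::field poly poly set) = bp.dim (deg_less d :: 'k poly poly set) + Suc d"
  using dim_deg_less[of d, where ?'k = 'k] dim_deg_less[of "Suc d", where ?'k = 'k] by simp

text \<open>Passing to \<open>n'\<close> and \<open>d - 1\<close> lowers the number of conditions by
  the sum of \<open>n\<close> on the line and the dimension of \<open>deg_less d\<close> by
  \<open>d\<close>. The rest is the estimate for the dimension of \<open>vanishing\<close>. A point
  with \<open>n p = 0\<close> contributes 0 to both sides, so truncation does no harm.\<close>

lemma defect_step:
  fixes a b :: "'p \<Rightarrow> 'k::field" and n :: "'p \<Rightarrow> nat" and c l :: 'k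
  assumes fin: "finite X" and inj: "inj_on (\<lambda>p. (a p, b p)) X" and A: "\<And>p. p \<in> X \<Longrightarrow> p \<in> A \<longleftrightarrow> b p = c + l * a p"
    and d: "0 < d"
  defines "n' \<equiv> \<lambda>p. n p - of_bool (p \<in> A)"
  shows "(\<Sum>p\<in>X \<inter> A. n p) \<le> d \<Longrightarrow> defect X a b n d \<le> defect X a b n' (d - 1)"
    and "d \<le> (\<Sum>p\<in>X \<inter> A. n p) \<Longrightarrow>
      defect X a b n d = defect X a b n' (d - 1) + (int (\<Sum>p\<in>X \<inter> A. n p) - int d)"
proof -
  let ?D = "\<lambda>d. int (bp.dim (deg_less d :: 'k poly poly set))"
  have XA: "X \<inter> A = {p\<in>X. b p = c + l * a p}" using A by auto
  have van: "vanishing X a b n' (d - 1) = vanishing X a b (\<lambda>p. n p - of_bool (b p = c + l * a p)) (d - 1)"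
    using A by (auto simp: vanishing_def n'_def)
  note step = dim_vanishing_step[OF fin inj, where c = c and l = l and n = n and d = d, folded XA van]
  have "?D (n p) = ?D (n' p) + (if p \<in> A then int (n p) else 0)" for p
    using dim_deg_less_Suc[of "n p - 1", where ?'k = 'k] by (cases "n p") (auto simp: n'_def)
  then have "(\<Sum>p\<in>X. ?D (n p)) = (\<Sum>p\<in>X. ?D (n' p)) + int (\<Sum>p\<in>X \<inter> A. n p)"
    using fin by (simp add: sum.distrib sum.inter_restrict if_distrib[of int] cong: if_cong)
  moreover have "?D d = ?D (d - 1) + int d"
    using dim_deg_less_Suc[of "d - 1", where ?'k = 'k] d by simp
  ultimately have eq: "defect X a b n d = defect X a b n' (d - 1) + int (\<Sum>p\<in>X \<inter> A. n p) - int d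
      + int (bp.dim (vanishing X a b n d)) - int (bp.dim (vanishing X a b n' (d - 1)))"
    by (simp add: defect_def)
  show "(\<Sum>p\<in>X \<inter> A. n p) \<le> d \<Longrightarrow> defect X a b n d \<le> defect X a b n' (d - 1)"
    using eq step(2) by linarith
  show "defect X a b n d = defect X a b n' (d - 1) + (int (\<Sum>p\<in>X \<inter> A. n p) - int d)"
    if "d \<le> (\<Sum>p\<in>X \<inter> A. n p)"
    using eq step that by linarith
qed

section \<open>An affine chart of the projective plane\<close>

lemma poly_mapping_sum_single:
  fixes F :: "'a \<Rightarrow>\<^sub>0 'b::comm_monoid_add"
  shows "F = (\<Sum>e\<in>Poly_Mapping.keys F. Poly_Mapping.single e (Poly_Mapping.lookup F e))"
  by (rule poly_mapping_eqI) (auto simp: lookup_sum lookup_single when_def in_keys_iff)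

lemma poly_mapping_single_induct [case_names zero add]:
  fixes F :: "'a \<Rightarrow>\<^sub>0 'b::comm_monoid_add"
  assumes "P 0" "\<And>e c F. P F \<Longrightarrow> P (Poly_Mapping.single e c + F)"
  shows "P F"
proof -
  have "P (\<Sum>e\<in>A. Poly_Mapping.single e (Poly_Mapping.lookup F e))" if "finite A" for A
    using that by induction (auto simp: assms)
  from this[of "Poly_Mapping.keys F"] show ?thesis
    using poly_mapping_sum_single[of F] by simp
qed

lemma poly3_single_eq: "Poly_Mapping.single (i, j, k) c = Poly_Mapping.single 0 c *
    Poly_Mapping.single (1, 0, 0) (1 :: 'k::comm_ring_1) ^ i * Poly_Mapping.single (0, 1, 0) 1 ^ j * Poly_Mapping.single (0, 0, 1) 1 ^ k"
proof -
  have 1: "Poly_Mapping.single (1, 0, 0) (1 :: 'k) ^ i = Poly_Mapping.single (i, 0, 0) 1" for i :: nat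
    by (induction i) (auto simp: mult_single simp flip: zero_prod_def)
  have 2: "Poly_Mapping.single (0, 1, 0) (1 :: 'k) ^ i = Poly_Mapping.single (0, i, 0) 1" for i :: nat
    by (induction i) (auto simp: mult_single simp flip: zero_prod_def)
  have 3: "Poly_Mapping.single (0, 0, 1) (1 :: 'k) ^ i = Poly_Mapping.single (0, 0, i) 1" for i :: nat
    by (induction i) (auto simp: mult_single simp flip: zero_prod_def)
  show ?thesis unfolding 1 2 3 by (simp add: mult_single)
qed

lemma homogeneous_0 [simp]: "homogeneous t 0"
  by (simp add: homogeneous_def)

lemma homogeneous_add: "homogeneous t F \<Longrightarrow> homogeneous t G \<Longrightarrow> homogeneous t (F + G)"
  using keys_add[of F G] by (auto simp: homogeneous_def)

lemma homogeneous_sum: "(\<And>x. x \<in> A \<Longrightarrow> homogeneous t (G x)) \<Longrightarrow> homogeneous t (sum G A)"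
  by (induction A rule: infinite_finite_induct) (auto intro: homogeneous_add)

lemma homogeneous_mult:
  assumes "homogeneous s F" "homogeneous t G" shows "homogeneous (s + t) (F * G)"
  using keys_mult[of F G] assms by (fastforce simp: homogeneous_def mdeg_def)

lemma homogeneous_1 [simp]: "homogeneous 0 1"
  by (simp add: homogeneous_def mdeg_def)

lemma homogeneous_power: "homogeneous s F \<Longrightarrow> homogeneous (s * n) (F ^ n)"
  by (induction n) (use homogeneous_mult[of s F] in auto)

lemma homogeneous_const [simp]: "homogeneous 0 (Poly_Mapping.single 0 c)"
  by (simp add: homogeneous_def mdeg_def)

lemma ideal_gen_superset: "s \<in> S \<Longrightarrow> s \<in> ideal_gen S"
  using ideal_gen.step[OF _ ideal_gen.zero, of s S 1] by simp

lemma ideal_gen_add: "x \<in> ideal_gen S \<Longrightarrow> y \<in> ideal_gen S \<Longrightarrow> x + y \<in> ideal_gen S"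
  by (induction rule: ideal_gen.induct) (auto simp: add.assoc intro: ideal_gen.step)

lemma ideal_gen_mult: "x \<in> ideal_gen S \<Longrightarrow> c * x \<in> ideal_gen S"
  by (induction rule: ideal_gen.induct) (auto simp: distrib_left mult.assoc[symmetric] intro: ideal_gen.intros)

lemma ideal_pow_0_mem: "0 \<in> ideal_pow I m"
  by (cases m) (auto intro: ideal_gen.zero)

lemma ideal_pow_add: "x \<in> ideal_pow I m \<Longrightarrow> y \<in> ideal_pow I m \<Longrightarrow> x + y \<in> ideal_pow I m"
  by (cases m) (auto intro: ideal_gen_add)

lemma ideal_pow_mult: "x \<in> ideal_pow I m \<Longrightarrow> c * x \<in> ideal_pow I m"
  by (cases m) (auto intro: ideal_gen_mult)

lemma ideal_pow_sum: "(\<And>x. x \<in> A \<Longrightarrow> G x \<in> ideal_pow I m) \<Longrightarrow> sum G A \<in> ideal_pow I m"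
  by (induction A rule: infinite_finite_induct) (auto intro: ideal_pow_add ideal_pow_0_mem)

lemma ideal_pow_Suc_mult: "a \<in> I \<Longrightarrow> x \<in> ideal_pow I m \<Longrightarrow> a * x \<in> ideal_pow I (Suc m)"
  by (auto intro!: ideal_gen_superset)

lemma ideal_pow_antimono:
  assumes "m \<le> n" shows "ideal_pow I n \<subseteq> ideal_pow I m"
  using assms
proof (induction m n rule: diff_induct)
  case (3 m n)
  then have le: "ideal_pow I n \<subseteq> ideal_pow I m" by simp
  show ?case
  proof
    fix x assume "x \<in> ideal_pow I (Suc n)"
    then have "x \<in> ideal_gen {a * b |a b. a \<in> I \<and> b \<in> ideal_pow I n}" by simp
    then show "x \<in> ideal_pow I (Suc m)"
      using le by induction (auto intro!: ideal_gen.intros)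
  qed
qed auto

lemma ideal_pow_power_mult: "a \<in> I \<Longrightarrow> x \<in> ideal_pow I m \<Longrightarrow> a ^ k * x \<in> ideal_pow I (k + m)"
  by (induction k) (auto simp: mult.assoc simp del: ideal_pow.simps(2) intro: ideal_pow_Suc_mult)

text \<open>The dehomogenization along the linear form \<open>fA \<mu> \<nu>\<close> below: it substitutes \<open>x\<^sub>0 = z\<close>,
  \<open>x\<^sub>1 = 1 - \<nu> y + \<mu> z\<close>, \<open>x\<^sub>2 = y + \<mu>\<^sup>2 z\<close>. The vertical lines of this chart are those through
  \<open>(1, \<mu>, \<mu>\<^sup>2)\<close>, so for generic \<open>\<mu>\<close> none of finitely many given lines is vertical, and for
  generic \<open>\<nu>\<close> the line at infinity avoids the given points.\<close>

definition chart :: "'k::field \<Rightarrow> 'k \<Rightarrow> 'k poly3 \<Rightarrow> 'k poly poly" where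
  "chart \<mu> \<nu> F = (\<Sum>e\<in>Poly_Mapping.keys F. [:[:Poly_Mapping.lookup F e:]:] * [:0, 1:] ^ fst e
     * [:[:1, -\<nu>:], [:\<mu>:]:] ^ fst (snd e) * [:[:0, 1:], [:\<mu>\<^sup>2:]:] ^ snd (snd e))"

lemma chart_superset:
  assumes "finite A" "Poly_Mapping.keys F \<subseteq> A"
  shows "chart \<mu> \<nu> F = (\<Sum>e\<in>A. [:[:Poly_Mapping.lookup F e:]:] * [:0, 1:] ^ fst e
     * [:[:1, -\<nu>:], [:\<mu>:]:] ^ fst (snd e) * [:[:0, 1:], [:\<mu>\<^sup>2:]:] ^ snd (snd e))"
  unfolding chart_def using assms by (intro sum.mono_neutral_left) (auto simp: in_keys_iff)

lemma chart_0 [simp]: "chart \<mu> \<nu> 0 = 0"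
  by (simp add: chart_def)

lemma chart_add: "chart \<mu> \<nu> (F + G) = chart \<mu> \<nu> F + chart \<mu> \<nu> G"
proof -
  let ?A = "Poly_Mapping.keys F \<union> Poly_Mapping.keys G"
  have c: "[:[:x + y:]:] = [:[:x:]:] + [:[:y:]:]" for x y :: 'a by simp
  have "chart \<mu> \<nu> H = (\<Sum>e\<in>?A. [:[:Poly_Mapping.lookup H e:]:] * [:0, 1:] ^ fst e
     * [:[:1, -\<nu>:], [:\<mu>:]:] ^ fst (snd e) * [:[:0, 1:], [:\<mu>\<^sup>2:]:] ^ snd (snd e))"
    if "Poly_Mapping.keys H \<subseteq> ?A" for H
    using that by (intro chart_superset) auto
  from this[of F] this[of G] this[of "F + G"] keys_add[of F G] show ?thesis
    by (simp only: Un_upper1 Un_upper2 lookup_add c distrib_right sum.distrib)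
qed

lemma chart_single: "chart \<mu> \<nu> (Poly_Mapping.single e c) = [:[:c:]:] * [:0, 1:] ^ fst e
     * [:[:1, -\<nu>:], [:\<mu>:]:] ^ fst (snd e) * [:[:0, 1:], [:\<mu>\<^sup>2:]:] ^ snd (snd e)"
proof (cases "c = 0")
  case False
  then show ?thesis by (simp add: chart_def)
qed simp

lemma chart_single_mult: "chart \<mu> \<nu> (Poly_Mapping.single e c * G) = chart \<mu> \<nu> (Poly_Mapping.single e c) * chart \<mu> \<nu> G"
proof (induction G rule: poly_mapping_single_induct)
  case (add f d F)
  have "[:[:c * d:]:] = [:[:c:]:] * [:[:d:]:]" by simp
  then have "chart \<mu> \<nu> (Poly_Mapping.single e c * Poly_Mapping.single f d)
      = chart \<mu> \<nu> (Poly_Mapping.single e c) * chart \<mu> \<nu> (Poly_Mapping.single f d)"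
    by (simp only: mult_single chart_single fst_add snd_add power_add ac_simps)
  then show ?case by (simp only: distrib_left chart_add add)
qed simp

lemma chart_mult: "chart \<mu> \<nu> (F * G) = chart \<mu> \<nu> F * chart \<mu> \<nu> G"
proof (induction F rule: poly_mapping_single_induct)
  case (add e c F)
  show ?case by (simp only: distrib_right chart_add chart_single_mult add)
qed simp

lemma chart_1 [simp]: "chart \<mu> \<nu> 1 = 1"
  using chart_single[of \<mu> \<nu> 0 1] by (simp flip: one_pCons)

lemma chart_power: "chart \<mu> \<nu> (F ^ n) = chart \<mu> \<nu> F ^ n"
  by (induction n) (simp_all add: chart_mult)

lemma chart_const [simp]: "chart \<mu> \<nu> (Poly_Mapping.single 0 c) = [:[:c:]:]"
  by (simp add: chart_single)


lemma eval3_superset: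
  assumes "finite A" "Poly_Mapping.keys F \<subseteq> A"
  shows "eval3 F p = (\<Sum>e\<in>A. Poly_Mapping.lookup F e * fst p ^ fst e * fst (snd p) ^ fst (snd e) * snd (snd p) ^ snd (snd e))"
  unfolding eval3_def using assms by (intro sum.mono_neutral_left) (auto simp: in_keys_iff)

lemma eval3_add: "eval3 (F + G) p = eval3 F p + eval3 G p"
  using keys_add[of F G]
  by (simp add: eval3_superset[of "Poly_Mapping.keys F \<union> Poly_Mapping.keys G"] lookup_add distrib_right sum.distrib)

lemma eval3_single: "eval3 (Poly_Mapping.single e c) p = c * fst p ^ fst e * fst (snd p) ^ fst (snd e) * snd (snd p) ^ snd (snd e)"
  by (cases "c = 0") (simp_all add: eval3_def)

lemma eval3_scale:
  assumes "homogeneous t F"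
  shows "eval3 F (c * x, c * y, c * z) = c ^ t * eval3 F (x, y, z)"
  unfolding eval3_def sum_distrib_left
proof (rule sum.cong)
  fix e assume "e \<in> Poly_Mapping.keys F"
  then have "t = fst e + fst (snd e) + snd (snd e)" using assms by (auto simp: homogeneous_def mdeg_def)
  then show "Poly_Mapping.lookup F e * fst (c * x, c * y, c * z) ^ fst e * fst (snd (c * x, c * y, c * z)) ^ fst (snd e) *
         snd (snd (c * x, c * y, c * z)) ^ snd (snd e) =
         c ^ t * (Poly_Mapping.lookup F e * fst (x, y, z) ^ fst e * fst (snd (x, y, z)) ^ fst (snd e) * snd (snd (x, y, z)) ^ snd (snd e))"
    by (simp add: power_add power_mult_distrib)
qed simp

lemma eval_chart: "poly (poly (chart \<mu> \<nu> F) [:b:]) a = eval3 F (b, 1 - \<nu> * a + \<mu> * b, a + \<mu>\<^sup>2 * b)"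
  by (simp add: chart_def eval3_def poly_sum algebra_simps)

lemma bcoeff_shift_0: "bcoeff (shift a b f) 0 0 = poly (poly f [:b:]) a"
proof -
  have "bcoeff (shift a b f) 0 0 = poly (poly (shift a b f) 0) 0"
    by (simp add: bcoeff_def poly_0_coeff_0)
  also have "\<dots> = poly (pcompose (poly f [:b:]) [:a, 1:]) 0"
    by (simp add: shift_def poly_pcompose poly_map_poly_pcompose)
  also have "\<dots> = poly (poly f [:b:]) a" by (simp add: poly_pcompose)
  finally show ?thesis .
qed

lemma bcoeff_mult: "bcoeff (f * g) i j = (\<Sum>k\<le>i. \<Sum>l\<le>j. bcoeff f k l * bcoeff g (i - k) (j - l))"
  by (simp add: bcoeff_def coeff_mult coeff_sum)

lemma ord_ge_mult: "f \<in> ord_ge m \<Longrightarrow> g \<in> ord_ge n \<Longrightarrow> f * g \<in> ord_ge (m + n)"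
proof -
  assume f: "f \<in> ord_ge m" and g: "g \<in> ord_ge n"
  have "bcoeff f k l * bcoeff g (i - k) (j - l) = 0" if "i + j < m + n" "k \<le> i" "l \<le> j" for i j k l
  proof -
    have "k + l < m \<or> (i - k) + (j - l) < n" using that by linarith
    then show ?thesis using f g by (auto simp: ord_ge_def)
  qed
  then show ?thesis unfolding ord_ge_def mem_Collect_eq bcoeff_mult by (auto intro!: sum.neutral)
qed

lemma ord_ge_add: "f \<in> ord_ge m \<Longrightarrow> g \<in> ord_ge m \<Longrightarrow> f + g \<in> ord_ge m"
  by (simp add: ord_ge_def)

lemma ord_ge_0_mem: "0 \<in> ord_ge m" and ord_ge_0: "ord_ge 0 = UNIV"
  by (simp_all add: ord_ge_def)

lemma ord_ge_mult_left: "f \<in> ord_ge m \<Longrightarrow> g * f \<in> ord_ge m"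
  using ord_ge_mult[of g 0 f m] by (simp add: ord_ge_0)

section \<open>Powers of a point ideal as an order of vanishing in the chart\<close>

definition chart_point :: "'k::field \<Rightarrow> 'k \<Rightarrow> 'k \<Rightarrow> 'k \<Rightarrow> 'k \<times> 'k \<times> 'k" where
  "chart_point \<mu> \<nu> a b = (b, 1 - \<nu> * a + \<mu> * b, a + \<mu>\<^sup>2 * b)"

text \<open>A generator of the point ideal is homogeneous, so it vanishes at every representative of
  the point, in particular at the one in the chart; its value there is the constant Taylor
  coefficient.\<close>

lemma point_ideal_ord_ge:
  assumes p: "proportional (chart_point \<mu> \<nu> a b) p" and F: "F \<in> point_ideal p"
  shows "shift a b (chart \<mu> \<nu> F) \<in> ord_ge 1"
  using F unfolding point_ideal_def
proof induction
  case (step G x c)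
  then obtain t where "homogeneous t G" "eval3 G p = 0" by auto
  then have "eval3 G (chart_point \<mu> \<nu> a b) = 0"
    using p eval3_scale[of t G] by (auto simp: proportional_def chart_point_def)
  then have "shift a b (chart \<mu> \<nu> G) \<in> ord_ge 1"
    using bcoeff_shift_0[of a b "chart \<mu> \<nu> G"] by (simp add: ord_ge_def eval_chart chart_point_def)
  then show ?case
    using step by (simp add: chart_add chart_mult shift_add shift_mult ord_ge_add ord_ge_mult_left)
qed (simp add: ord_ge_0_mem)

lemma ideal_pow_ord_ge:
  assumes p: "proportional (chart_point \<mu> \<nu> a b) p" and F: "F \<in> ideal_pow (point_ideal p) m"
  shows "shift a b (chart \<mu> \<nu> F) \<in> ord_ge m"
  using F
proof (induction m arbitrary: F)
  case 0
  show ?case by (simp add: ord_ge_0)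
next
  case (Suc m)
  from Suc.prems have "F \<in> ideal_gen {a * b |a b. a \<in> point_ideal p \<and> b \<in> ideal_pow (point_ideal p) m}" by simp
  then show ?case
  proof induction
    case (step G x c)
    then obtain u v where G: "G = u * v" "u \<in> point_ideal p" "v \<in> ideal_pow (point_ideal p) m" by auto
    have "shift a b (chart \<mu> \<nu> G) \<in> ord_ge (1 + m)"
      unfolding G(1) chart_mult shift_mult using point_ideal_ord_ge[OF p G(2)] Suc.IH[OF G(3)]
      by (rule ord_ge_mult)
    then show ?case
      using step by (simp add: chart_add chart_mult shift_add shift_mult ord_ge_add ord_ge_mult_left)
  qed (simp add: ord_ge_0_mem)
qed

definition lform :: "'k::comm_ring_1 \<Rightarrow> 'k \<Rightarrow> 'k \<Rightarrow> 'k poly3" where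
  "lform u v w = Poly_Mapping.single (1, 0, 0) u + Poly_Mapping.single (0, 1, 0) v + Poly_Mapping.single (0, 0, 1) w"

lemma homogeneous_lform: "homogeneous 1 (lform u v w)"
  unfolding lform_def by (intro homogeneous_add) (auto simp: homogeneous_def mdeg_def)

lemma eval3_lform: "eval3 (lform u v w) p = u * fst p + v * fst (snd p) + w * snd (snd p)"
  by (simp add: lform_def eval3_add eval3_single)

lemma lform_add: "lform u v w + lform u' v' w' = lform (u + u') (v + v') (w + w')"
  by (simp add: lform_def single_add algebra_simps)

lemma lform_scale: "Poly_Mapping.single 0 c * lform u v w = lform (c * u) (c * v) (c * w)"
  by (simp add: lform_def distrib_left mult_single)

lemma chart_lform: "chart \<mu> \<nu> (lform u v w) = [:[:v, w - \<nu> * v:], [:u + \<mu> * v + \<mu>\<^sup>2 * w:]:]"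
  by (simp add: lform_def chart_add chart_single one_pCons algebra_simps)

text \<open>The basis of linear forms dual to the chart with origin moved to \<open>(a, b)\<close>: after the shift,
  \<open>fA\<close>, \<open>fB\<close>, \<open>fC\<close> become \<open>1\<close>, \<open>y\<close>, \<open>z\<close>, and \<open>fB\<close>, \<open>fC\<close> generate the ideal of the point.\<close>

definition fA :: "'k::field \<Rightarrow> 'k \<Rightarrow> 'k poly3" where
  "fA \<mu> \<nu> = lform (-\<mu> - \<nu> * \<mu>\<^sup>2) 1 \<nu>"

definition fB :: "'k::field \<Rightarrow> 'k \<Rightarrow> 'k \<Rightarrow> 'k poly3" where
  "fB \<mu> \<nu> a = lform (-(\<mu>\<^sup>2) - a * (-\<mu> - \<nu> * \<mu>\<^sup>2)) (-a) (1 - a * \<nu>)"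

definition fC :: "'k::field \<Rightarrow> 'k \<Rightarrow> 'k \<Rightarrow> 'k poly3" where
  "fC \<mu> \<nu> b = lform (1 - b * (-\<mu> - \<nu> * \<mu>\<^sup>2)) (-b) (-b * \<nu>)"

lemma chart_fA: "chart \<mu> \<nu> (fA \<mu> \<nu>) = 1"
  by (simp add: fA_def chart_lform one_pCons algebra_simps)

lemma chart_fB: "chart \<mu> \<nu> (fB \<mu> \<nu> a) = [:[:-a, 1:]:]"
  by (simp add: fB_def chart_lform algebra_simps power2_eq_square)

lemma chart_fC: "chart \<mu> \<nu> (fC \<mu> \<nu> b) = [:[:-b:], 1:]"
  by (simp add: fC_def chart_lform one_pCons algebra_simps power2_eq_square)

lemma shift_y_a: "shift a b [:[:-a, 1:]:] = [:[:0, 1:]:]"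
  by (simp add: shift_def map_poly_pCons_pcompose pcompose_pCons)

lemma shift_z_b: "shift a b [:[:-b:], 1:] = [:0, 1:]"
  by (simp add: shift_def map_poly_pCons_pcompose pcompose_pCons one_pCons)

lemma shift_1 [simp]: "shift a b 1 = 1"
  using shift_const[of a b 1] by (simp flip: one_pCons)

lemma shift_power: "shift a b (f ^ n) = shift a b f ^ n"
  by (induction n) (simp_all add: shift_mult)

lemma monom_monom: "[:[:c:]:] * [:[:0, 1:]:] ^ j * [:0, 1:] ^ i = (monom (monom c j) i :: 'k::field poly poly)"
proof -
  have "[:[:0, 1:]:] ^ j = ([:monom 1 j:] :: 'k poly poly)"
    by (induction j) (simp_all add: monom_altdef one_pCons algebra_simps)
  then show ?thesis
    by (simp add: monom_altdef)
qed

text \<open>By \<open>homogeneous_form_span\<close> this contains every form of degree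
  \<open>t\<close>. The inductive presentation provides an induction over monomials in the
  coordinates adapted to (a, b).\<close>

inductive_set form_span :: "'k::field \<Rightarrow> 'k \<Rightarrow> 'k \<Rightarrow> 'k \<Rightarrow> nat \<Rightarrow> 'k poly3 set" for \<mu> \<nu> a b t where
  zero: "0 \<in> form_span \<mu> \<nu> a b t"
| step: "i + j + k = t \<Longrightarrow> G \<in> form_span \<mu> \<nu> a b t \<Longrightarrow>
    Poly_Mapping.single 0 c * fA \<mu> \<nu> ^ k * fB \<mu> \<nu> a ^ j * fC \<mu> \<nu> b ^ i + G \<in> form_span \<mu> \<nu> a b t"

lemma form_span_add: "F \<in> form_span \<mu> \<nu> a b t \<Longrightarrow> G \<in> form_span \<mu> \<nu> a b t \<Longrightarrow> F + G \<in> form_span \<mu> \<nu> a b t"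
  by (induction rule: form_span.induct) (auto simp: add.assoc intro: form_span.step)

lemma form_span_scale: "F \<in> form_span \<mu> \<nu> a b t \<Longrightarrow> Poly_Mapping.single 0 c * F \<in> form_span \<mu> \<nu> a b t"
proof (induction rule: form_span.induct)
  case (step i j k G d)
  have "Poly_Mapping.single 0 c * (Poly_Mapping.single 0 d * fA \<mu> \<nu> ^ k * fB \<mu> \<nu> a ^ j * fC \<mu> \<nu> b ^ i + G)
    = Poly_Mapping.single 0 (c * d) * fA \<mu> \<nu> ^ k * fB \<mu> \<nu> a ^ j * fC \<mu> \<nu> b ^ i + Poly_Mapping.single 0 c * G"
    by (simp add: distrib_left mult.assoc[symmetric] mult_single)
  then show ?case using step form_span.step by metis
qed (simp add: form_span.zero)

lemma form_span_mult_basis: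
  assumes "F \<in> form_span \<mu> \<nu> a b t"
  shows "fA \<mu> \<nu> * F \<in> form_span \<mu> \<nu> a b (Suc t)" "fB \<mu> \<nu> a * F \<in> form_span \<mu> \<nu> a b (Suc t)"
    "fC \<mu> \<nu> b * F \<in> form_span \<mu> \<nu> a b (Suc t)"
proof -
  let ?m = "\<lambda>c k j i. Poly_Mapping.single 0 c * fA \<mu> \<nu> ^ k * fB \<mu> \<nu> a ^ j * fC \<mu> \<nu> b ^ i"
  have eqs: "fA \<mu> \<nu> * (?m c k j i + G) = ?m c (Suc k) j i + fA \<mu> \<nu> * G"
    "fB \<mu> \<nu> a * (?m c k j i + G) = ?m c k (Suc j) i + fB \<mu> \<nu> a * G"
    "fC \<mu> \<nu> b * (?m c k j i + G) = ?m c k j (Suc i) + fC \<mu> \<nu> b * G" for c k j i G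
    by (simp_all add: algebra_simps)
  have "fA \<mu> \<nu> * F \<in> form_span \<mu> \<nu> a b (Suc t) \<and> fB \<mu> \<nu> a * F \<in> form_span \<mu> \<nu> a b (Suc t)
    \<and> fC \<mu> \<nu> b * F \<in> form_span \<mu> \<nu> a b (Suc t)"
    using assms
  proof induction
    case (step i j k G c)
    then show ?case unfolding eqs by (intro conjI form_span.step) auto
  qed (simp add: form_span.zero)
  then show "fA \<mu> \<nu> * F \<in> form_span \<mu> \<nu> a b (Suc t)" "fB \<mu> \<nu> a * F \<in> form_span \<mu> \<nu> a b (Suc t)"
    "fC \<mu> \<nu> b * F \<in> form_span \<mu> \<nu> a b (Suc t)" by blast+
qed

lemma form_span_mult_lform:
  assumes F: "F \<in> form_span \<mu> \<nu> a b t"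
  shows "lform u v w * F \<in> form_span \<mu> \<nu> a b (Suc t)"
proof -
  let ?C = "Poly_Mapping.single 0 :: 'a \<Rightarrow> 'a poly3"
  define q where "q = u + \<mu> * v + \<mu>\<^sup>2 * w"
  \<comment> \<open>In the chart the form is v + (w - \<open>\<nu>\<close> v) y + q z. Writing y =
    (y - a) + a and z = (z - b) + b gives its coefficients with respect to \<open>fA\<close>,
    \<open>fB\<close>, \<open>fC\<close>.\<close>
  have "lform u v w = ?C (v + a * (w - \<nu> * v) + b * q) * fA \<mu> \<nu> + ?C (w - \<nu> * v) * fB \<mu> \<nu> a + ?C q * fC \<mu> \<nu> b"
    unfolding fA_def fB_def fC_def lform_scale lform_add q_def
    by (intro arg_cong3[where f = lform]) (simp_all add: algebra_simps power2_eq_square)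
  then have "lform u v w * F = ?C (v + a * (w - \<nu> * v) + b * q) * (fA \<mu> \<nu> * F)
     + ?C (w - \<nu> * v) * (fB \<mu> \<nu> a * F) + ?C q * (fC \<mu> \<nu> b * F)"
    by (simp add: distrib_right mult.assoc)
  then show ?thesis
    using form_span_mult_basis[OF F] by (simp add: form_span_add form_span_scale)
qed

lemma homogeneous_form_span:
  assumes "homogeneous t F"
  shows "F \<in> form_span \<mu> \<nu> a b t"
proof -
  have one: "1 \<in> form_span \<mu> \<nu> a b 0"
    using form_span.step[of 0 0 0 0 0 \<mu> \<nu> a b 1] by (simp add: form_span.zero)
  have pow: "lform u v w ^ n * G \<in> form_span \<mu> \<nu> a b (n + k)" if "G \<in> form_span \<mu> \<nu> a b k" for u v w n k G
    by (induction n) (auto simp: that mult.assoc intro: form_span_mult_lform)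
  have x: "Poly_Mapping.single (1, 0, 0) 1 = lform 1 0 (0 :: 'a)" "Poly_Mapping.single (0, 1, 0) 1 = lform 0 1 (0 :: 'a)"
    "Poly_Mapping.single (0, 0, 1) 1 = lform 0 0 (1 :: 'a)"
    by (simp_all add: lform_def)
  have single: "Poly_Mapping.single e c \<in> form_span \<mu> \<nu> a b (mdeg e)" for e c
  proof -
    obtain i j k where e: "e = (i, j, k)" by (metis prod.exhaust)
    have "lform 1 0 0 ^ i * (lform 0 1 0 ^ j * (lform 0 0 1 ^ k * 1)) \<in> form_span \<mu> \<nu> a b (i + (j + (k + 0)))"
      by (intro pow one)
    then have "Poly_Mapping.single 0 c * (lform 1 0 0 ^ i * (lform 0 1 0 ^ j * (lform 0 0 1 ^ k * 1))) \<in> form_span \<mu> \<nu> a b (mdeg e)"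
      by (intro form_span_scale) (simp add: e mdeg_def add.assoc)
    then show ?thesis unfolding e poly3_single_eq[of i j k c] x by (simp add: mult.assoc)
  qed
  have "(\<Sum>e\<in>A. Poly_Mapping.single e (Poly_Mapping.lookup F e)) \<in> form_span \<mu> \<nu> a b t"
    if "finite A" "A \<subseteq> Poly_Mapping.keys F" for A
    using that
  proof induction
    case (insert e A)
    then have "mdeg e = t" using assms by (auto simp: homogeneous_def)
    then show ?case using insert single[of e] by (auto intro: form_span_add)
  qed (simp add: form_span.zero)
  from this[of "Poly_Mapping.keys F"] show ?thesis using poly_mapping_sum_single[of F] by simp
qed

text \<open>Inverse, on forms of degree \<open>t\<close>, to \<open>chart\<close> followed by
  \<open>shift a b\<close>; for a = b = 0 it is ordinary homogenization.\<close>

definition homogenize :: "'k::field \<Rightarrow> 'k \<Rightarrow> 'k \<Rightarrow> 'k \<Rightarrow> nat \<Rightarrow> 'k poly poly \<Rightarrow> 'k poly3" where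
  "homogenize \<mu> \<nu> a b t f = (\<Sum>(i, j)\<in>{(i, j). i + j \<le> t}.
     Poly_Mapping.single 0 (bcoeff f i j) * fA \<mu> \<nu> ^ (t - i - j) * fB \<mu> \<nu> a ^ j * fC \<mu> \<nu> b ^ i)"

lemma finite_degree_pairs: "finite {(i :: nat, j). i + j \<le> t}"
  by (rule finite_subset[of _ "{..t} \<times> {..t}"]) auto

lemma homogenize_add: "homogenize \<mu> \<nu> a b t (f + g) = homogenize \<mu> \<nu> a b t f + homogenize \<mu> \<nu> a b t g"
  by (simp add: homogenize_def single_add distrib_right case_prod_unfold sum.distrib)

lemma homogenize_monom:
  assumes "i + j \<le> t"
  shows "homogenize \<mu> \<nu> a b t (monom (monom c j) i) = Poly_Mapping.single 0 c * fA \<mu> \<nu> ^ (t - i - j) * fB \<mu> \<nu> a ^ j * fC \<mu> \<nu> b ^ i"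
proof -
  have "homogenize \<mu> \<nu> a b t (monom (monom c j) i) = (\<Sum>e\<in>{(i, j). i + j \<le> t}. if e = (i, j) then
     Poly_Mapping.single 0 c * fA \<mu> \<nu> ^ (t - i - j) * fB \<mu> \<nu> a ^ j * fC \<mu> \<nu> b ^ i else 0)"
    unfolding homogenize_def by (intro sum.cong) (auto split: if_splits)
  then show ?thesis using assms finite_degree_pairs[of t] by simp
qed

lemma shift_chart_monomial:
  "shift a b (chart \<mu> \<nu> (Poly_Mapping.single 0 c * fA \<mu> \<nu> ^ k * fB \<mu> \<nu> a ^ j * fC \<mu> \<nu> b ^ i)) = monom (monom c j) i"
  unfolding chart_mult chart_power chart_fA chart_fB chart_fC shift_mult shift_power shift_y_a shift_z_b chart_const shift_const shift_1
  using monom_monom[of c j i] by simp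

lemma homogenize_shift_chart:
  assumes "homogeneous t F"
  shows "homogenize \<mu> \<nu> a b t (shift a b (chart \<mu> \<nu> F)) = F"
  using homogeneous_form_span[OF assms, of \<mu> \<nu> a b]
proof induction
  case zero
  show ?case by (simp add: homogenize_def case_prod_unfold)
next
  case (step i j k G c)
  then show ?case
    by (auto simp: chart_add shift_add homogenize_add shift_chart_monomial homogenize_monom)
qed

lemma homogeneous_basis: "homogeneous 1 (fA \<mu> \<nu>)" "homogeneous 1 (fB \<mu> \<nu> a)" "homogeneous 1 (fC \<mu> \<nu> b)"
  by (simp_all add: fA_def fB_def fC_def homogeneous_lform[unfolded One_nat_def])

lemma homogeneous_homogenize: "homogeneous t (homogenize \<mu> \<nu> a b t f)"
proof -
  have "homogeneous t (Poly_Mapping.single 0 c * fA \<mu> \<nu> ^ (t - i - j) * fB \<mu> \<nu> a ^ j * fC \<mu> \<nu> b ^ i)" if "i + j \<le> t" for c i j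
  proof -
    have "homogeneous (0 + 1 * (t - i - j) + 1 * j + 1 * i)
      (Poly_Mapping.single 0 c * fA \<mu> \<nu> ^ (t - i - j) * fB \<mu> \<nu> a ^ j * fC \<mu> \<nu> b ^ i)"
      by (intro homogeneous_mult homogeneous_const homogeneous_power homogeneous_basis)
    then show ?thesis using that by simp
  qed
  then show ?thesis unfolding homogenize_def by (intro homogeneous_sum) auto
qed

lemma chart_monomial:
  "chart \<mu> \<nu> (Poly_Mapping.single 0 c * fA \<mu> \<nu> ^ k * fB \<mu> \<nu> 0 ^ j * fC \<mu> \<nu> 0 ^ i) = monom (monom c j) i"
  unfolding chart_mult chart_power chart_fA chart_fB chart_fC chart_const
  by (simp only: minus_zero pCons_0_0 power_one mult_1_right monom_monom)

lemma chart_homogenize: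
  assumes "f \<in> deg_less (Suc t)"
  shows "chart \<mu> \<nu> (homogenize \<mu> \<nu> 0 0 t f) = f"
proof -
  have sum: "chart \<mu> \<nu> (sum G A) = (\<Sum>x\<in>A. chart \<mu> \<nu> (G x))" if "finite A" for G :: "nat \<times> nat \<Rightarrow> 'a poly3" and A
    using that by induction (auto simp: chart_add)
  have eq: "chart \<mu> \<nu> (homogenize \<mu> \<nu> 0 0 t f) = (\<Sum>(i, j)\<in>{(i, j). i + j \<le> t}. monom (monom (bcoeff f i j) j) i)"
    unfolding homogenize_def sum[OF finite_degree_pairs] by (intro sum.cong) (auto simp: chart_monomial)
  show ?thesis
  proof (rule bcoeff_eqI)
    fix i j
    have "bcoeff (chart \<mu> \<nu> (homogenize \<mu> \<nu> 0 0 t f)) i j = (\<Sum>e\<in>{(i, j). i + j \<le> t}. if e = (i, j) then bcoeff f i j else 0)"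
      unfolding eq bcoeff_simps(5) by (intro sum.cong) (auto split: if_splits)
    also have "\<dots> = bcoeff f i j"
      using assms finite_degree_pairs[of t] by (auto simp: deg_less_def)
    finally show "bcoeff (chart \<mu> \<nu> (homogenize \<mu> \<nu> 0 0 t f)) i j = bcoeff f i j" .
  qed
qed

lemma chart_deg_less:
  assumes "homogeneous t F"
  shows "chart \<mu> \<nu> F \<in> deg_less (Suc t)"
  using homogeneous_form_span[OF assms, of \<mu> \<nu> 0 0]
proof induction
  case (step i j k G c)
  then show ?case by (auto simp: chart_add chart_monomial deg_less_def)
qed (simp add: deg_less_def)

lemma chart_eq_0:
  assumes "homogeneous t F" "chart \<mu> \<nu> F = 0"
  shows "F = 0"
  using homogenize_shift_chart[OF assms(1), of \<mu> \<nu> 0 0] assms(2) by (simp add: homogenize_def case_prod_unfold)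

text \<open>Expand \<open>F\<close> in monomials in \<open>fA\<close>, \<open>fB\<close>,
  \<open>fC\<close>. By the order condition every term with nonzero coefficient has at least
  \<open>m\<close> factors \<open>fB\<close> or \<open>fC\<close>, and both of these forms vanish at
  the point.\<close>

lemma ord_ge_ideal_pow:
  assumes p: "proportional (chart_point \<mu> \<nu> a b) p" and F: "homogeneous t F"
    and ord: "shift a b (chart \<mu> \<nu> F) \<in> ord_ge m"
  shows "F \<in> ideal_pow (point_ideal p) m"
proof -
  let ?I = "point_ideal p" and ?f = "shift a b (chart \<mu> \<nu> F)"
  obtain c where c: "p = (c * b, c * (1 - \<nu> * a + \<mu> * b), c * (a + \<mu>\<^sup>2 * b))"
    using p by (auto simp: proportional_def chart_point_def)
  have "eval3 (fB \<mu> \<nu> a) p = 0" "eval3 (fC \<mu> \<nu> b) p = 0"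
    by (simp_all add: fB_def fC_def eval3_lform c algebra_simps power2_eq_square)
  then have I: "fB \<mu> \<nu> a \<in> ?I" "fC \<mu> \<nu> b \<in> ?I"
    unfolding point_ideal_def using homogeneous_basis by (blast intro: ideal_gen_superset)+
  have mem: "Poly_Mapping.single 0 (bcoeff ?f i j) * fA \<mu> \<nu> ^ k * fB \<mu> \<nu> a ^ j * fC \<mu> \<nu> b ^ i \<in> ideal_pow ?I m" for i j k
  proof (cases "i + j < m")
    case True
    then have "bcoeff ?f i j = 0" using ord by (simp add: ord_ge_def)
    then show ?thesis by (simp add: ideal_pow_0_mem)
  next
    case False
    have "fB \<mu> \<nu> a ^ j * (fC \<mu> \<nu> b ^ i * (Poly_Mapping.single 0 (bcoeff ?f i j) * fA \<mu> \<nu> ^ k)) \<in> ideal_pow ?I (j + (i + 0))"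
      by (intro ideal_pow_power_mult I) simp
    then have "fB \<mu> \<nu> a ^ j * (fC \<mu> \<nu> b ^ i * (Poly_Mapping.single 0 (bcoeff ?f i j) * fA \<mu> \<nu> ^ k)) \<in> ideal_pow ?I m"
      using ideal_pow_antimono[of m "j + (i + 0)" ?I] False by auto
    then show ?thesis by (simp add: ac_simps)
  qed
  have "homogenize \<mu> \<nu> a b t ?f \<in> ideal_pow ?I m"
    unfolding homogenize_def by (intro ideal_pow_sum) (auto simp: mem)
  then show ?thesis using homogenize_shift_chart[OF F] by simp
qed

section \<open>The Hilbert function computed in the chart\<close>

lemma psmult_eq: "psmult c F = Poly_Mapping.single 0 c * F"
  unfolding psmult_def by (rule mult_map_scale_conv_mult)

global_interpretation p3: vector_space "psmult :: 'k::field \<Rightarrow> 'k poly3 \<Rightarrow> 'k poly3"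
  by unfold_locales
    (simp_all add: psmult_eq distrib_left distrib_right single_add mult_single flip: mult.assoc)

global_interpretation p3bp: vector_space_pair "psmult :: 'k::field \<Rightarrow> 'k poly3 \<Rightarrow> 'k poly3" cscale ..

lemma linear_chart: "Vector_Spaces.linear psmult cscale (chart \<mu> \<nu>)"
  by (simp add: Vector_Spaces.linear_iff p3.vector_space_axioms bp.vector_space_axioms chart_add psmult_eq chart_mult cscale_def)

lemma subspace_Rdeg: "p3.subspace (Rdeg t)"
  using homogeneous_mult[OF homogeneous_const, of t]
  by (auto simp: p3.subspace_def Rdeg_def homogeneous_add psmult_eq)

lemma subspace_fat_ideal: "p3.subspace (fat_ideal m X)"
  by (auto simp: p3.subspace_def fat_ideal_def psmult_eq ideal_pow_0_mem ideal_pow_add ideal_pow_mult)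

lemma kdim_image_chart:
  assumes "p3.subspace S" "S \<subseteq> Rdeg t"
  shows "kdim S = bp.dim (chart \<mu> \<nu> ` S)"
  unfolding kdim_def
  by (rule p3bp.dim_image_inj_on[OF linear_chart assms(1), symmetric])
    (use assms(2) in \<open>auto simp: Rdeg_def intro: chart_eq_0\<close>)

lemma kdim_Rdeg: "kdim (Rdeg t :: 'k::field poly3 set) = bp.dim (deg_less (Suc t) :: 'k poly poly set)"
proof -
  have "chart 0 0 ` (Rdeg t :: 'k poly3 set) = deg_less (Suc t)"
  proof (intro equalityI subsetI)
    fix f :: "'k poly poly" assume "f \<in> deg_less (Suc t)"
    then show "f \<in> chart 0 0 ` Rdeg t"
      using chart_homogenize[of f t 0 0] homogeneous_homogenize[of t 0 0 0 0 f]
      by (intro image_eqI[of _ _ "homogenize 0 0 0 0 t f"]) (simp_all add: Rdeg_def)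
  qed (auto simp: Rdeg_def chart_deg_less)
  then show ?thesis by (subst kdim_image_chart[OF subspace_Rdeg order_refl, of _ 0 0]) simp
qed

lemma kdim_fat_ideal:
  fixes X :: "('k::field \<times> 'k \<times> 'k) set"
  assumes "\<And>p. p \<in> X \<Longrightarrow> proportional (chart_point \<mu> \<nu> (a p) (b p)) p"
  shows "kdim (fat_ideal m X \<inter> Rdeg t) = bp.dim (vanishing X a b (\<lambda>_. m) (Suc t))"
proof -
  have iff: "F \<in> fat_ideal m X \<longleftrightarrow> (\<forall>p\<in>X. shift (a p) (b p) (chart \<mu> \<nu> F) \<in> ord_ge m)" if "homogeneous t F" for F
    using ideal_pow_ord_ge[OF assms] ord_ge_ideal_pow[OF assms that] by (auto simp: fat_ideal_def)
  have "chart \<mu> \<nu> ` (fat_ideal m X \<inter> Rdeg t) = vanishing X a b (\<lambda>_. m) (Suc t)"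
  proof (intro equalityI subsetI)
    fix f assume f: "f \<in> vanishing X a b (\<lambda>_. m) (Suc t)"
    let ?F = "homogenize \<mu> \<nu> 0 0 t f"
    have "chart \<mu> \<nu> ?F = f" using f by (intro chart_homogenize) (simp add: vanishing_def)
    then show "f \<in> chart \<mu> \<nu> ` (fat_ideal m X \<inter> Rdeg t)"
      using f iff[OF homogeneous_homogenize, of \<mu> \<nu> 0 0 f] homogeneous_homogenize[of t \<mu> \<nu> 0 0 f]
      by (intro image_eqI[of _ _ ?F]) (auto simp: vanishing_def Rdeg_def)
  qed (auto simp: vanishing_def Rdeg_def iff chart_deg_less)
  moreover have "p3.subspace (fat_ideal m X \<inter> Rdeg t)"
    using subspace_fat_ideal[of m X] subspace_Rdeg[of t] by (rule p3.subspace_inter)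
  ultimately show ?thesis using kdim_image_chart[of "fat_ideal m X \<inter> Rdeg t" t \<mu> \<nu>] by simp
qed

text \<open>The number of conditions is the same in both degrees and cancels. Since
  \<open>2 <= d\<close>, the two degrees d - 1 and d - 2 are nonnegative and the convention for
  negative arguments does not enter.\<close>

lemma dhilb_fat_ideal:
  fixes X :: "('k::field \<times> 'k \<times> 'k) set"
  assumes "\<And>p. p \<in> X \<Longrightarrow> proportional (chart_point \<mu> \<nu> (a p) (b p)) p" "2 \<le> d"
  shows "dhilb (fat_ideal m X) (int d - 1) = defect X a b (\<lambda>_. m) (d - 1) - defect X a b (\<lambda>_. m) d"
proof -
  obtain e where "d = Suc (Suc e)" using assms(2) by (metis add_2_eq_Suc le_Suc_ex)
  then show ?thesis
    by (simp add: dhilb_def hilb_def defect_def kdim_Rdeg kdim_fat_ideal[OF assms(1)] nat_add_distrib)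
qed

section \<open>Splitting off lines\<close>

text \<open>A configuration of type \<open>(1, \<dots>, s)\<close>, indexed from 0: the layer \<open>Xs i\<close> has \<open>i + 1\<close> points.\<close>

definition layered :: "'p set \<Rightarrow> 'p set set \<Rightarrow> nat \<Rightarrow> (nat \<Rightarrow> 'p set) \<Rightarrow> (nat \<Rightarrow> 'p set) \<Rightarrow> bool" where
  "layered X \<L> s Xs L \<longleftrightarrow> X = (\<Union>i<s. Xs i) \<and>
     (\<forall>i<s. card (Xs i) = Suc i \<and> L i \<in> \<L> \<and> Xs i \<subseteq> L i) \<and> (\<forall>i<s. \<forall>j<i. L i \<inter> Xs j = {})"

text \<open>The only incidence property of lines that the combinatorial part relies on.\<close>

definition meet_once :: "'p set \<Rightarrow> 'p set set \<Rightarrow> bool" where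
  "meet_once X \<L> \<longleftrightarrow> (\<forall>A\<in>\<L>. \<forall>B\<in>\<L>. A \<noteq> B \<longrightarrow> (\<forall>p\<in>X \<inter> A \<inter> B. \<forall>q\<in>X \<inter> A \<inter> B. p = q))"

section \<open>Lines with the maximal number of points in a layered configuration\<close>

lemma layeredD:
  assumes "layered X \<L> s Xs L"
  shows "X = (\<Union>i<s. Xs i)" "i < s \<Longrightarrow> card (Xs i) = Suc i" "i < s \<Longrightarrow> finite (Xs i)" "i < s \<Longrightarrow> L i \<in> \<L>"
    "i < s \<Longrightarrow> Xs i \<subseteq> L i" "i < s \<Longrightarrow> j < i \<Longrightarrow> L i \<inter> Xs j = {}" "finite X" "i < s \<Longrightarrow> Xs i \<subseteq> X"
    "i < s \<Longrightarrow> Xs i \<noteq> {}"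
proof -
  have fin: "finite (Xs i)" if "i < s" for i
    using assms that by (intro card_ge_0_finite) (simp add: layered_def)
  then show "i < s \<Longrightarrow> finite (Xs i)" "finite X" using assms by (auto simp: layered_def)
qed (use assms in \<open>auto simp: layered_def\<close>)

lemma layered_disjoint:
  assumes "layered X \<L> s Xs L" "i < s" "j < s" "i \<noteq> j"
  shows "Xs i \<inter> Xs j = {}"
  using layeredD(5,6)[OF assms(1)] assms(2-4) by (cases i j rule: linorder_cases) blast+

lemma layered_lines_distinct:
  assumes "layered X \<L> s Xs L" "i < s" "j < s" "i \<noteq> j"
  shows "L i \<noteq> L j"
proof -
  have "L i \<noteq> L j" if "i < j" "j < s" for i j
    using layeredD(5,9)[OF assms(1), of i] layeredD(6)[OF assms(1), of j i] that by force
  then show ?thesis using assms(2-4) by (metis linorder_neqE_nat)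
qed

lemma meet_once_card_le:
  assumes "meet_once X \<L>" "finite X" "A \<in> \<L>" "B \<in> \<L>" "A \<noteq> B" "C \<subseteq> X \<inter> A \<inter> B"
  shows "card C \<le> 1"
proof -
  have "finite C" using assms(2,6) finite_subset by blast
  then show ?thesis
    using assms unfolding meet_once_def One_nat_def by (subst card_le_Suc0_iff_eq) blast+
qed

lemma card_layered_line:
  assumes "layered X \<L> s Xs L"
  shows "card (X \<inter> A) = (\<Sum>j<s. card (Xs j \<inter> A))"
proof -
  have "X \<inter> A = (\<Union>j<s. Xs j \<inter> A)" using layeredD(1)[OF assms] by auto
  moreover have "card (\<Union>j<s. Xs j \<inter> A) = (\<Sum>j<s. card (Xs j \<inter> A))"
  proof (rule card_UN_disjoint)
    show "\<forall>i\<in>{..<s}. finite (Xs i \<inter> A)" using layeredD(3)[OF assms] by simp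
    show "\<forall>i\<in>{..<s}. \<forall>j\<in>{..<s}. i \<noteq> j \<longrightarrow> Xs i \<inter> A \<inter> (Xs j \<inter> A) = {}"
      using layered_disjoint[OF assms] by blast
  qed simp
  ultimately show ?thesis by (simp only:)
qed

lemma card_layer_line_le_1:
  assumes lay: "layered X \<L> s Xs L" and once: "meet_once X \<L>" and A: "A \<in> \<L>" and j: "j < s" "A \<noteq> L j"
  shows "card (Xs j \<inter> A) \<le> 1"
proof (rule meet_once_card_le[OF once layeredD(7)[OF lay] A layeredD(4)[OF lay j(1)] j(2)])
  show "Xs j \<inter> A \<subseteq> X \<inter> A \<inter> L j" using layeredD(5,8)[OF lay j(1)] by blast
qed

text \<open>The bounds sum to \<open>s\<close> over all layers, so a line \<open>L i\<close> with
  \<open>s\<close> points must attain every one of them.\<close>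

lemma card_layer_line_le:
  assumes lay: "layered X \<L> s Xs L" and once: "meet_once X \<L>" and i: "i < s" and j: "j < s"
  shows "card (Xs j \<inter> L i) \<le> (if j < i then 0 else if j = i then Suc i else 1)"
proof (cases j i rule: linorder_cases)
  case less
  then show ?thesis using layeredD(6)[OF lay i, of j] by (simp add: Int_commute)
next
  case equal
  then show ?thesis using card_mono[of "Xs i" "Xs i \<inter> L i"] layeredD(2,3)[OF lay i] by simp
next
  case greater
  then show ?thesis
    using card_layer_line_le_1[OF lay once layeredD(4)[OF lay i] j] layered_lines_distinct[OF lay i j] by simp
qed

lemma sum_layer_bounds: "(\<Sum>j<k. if j < i then 0 else if j = i then Suc i else 1) = (if i < k then k else 0)"
  by (induction k) auto

lemma card_line_le:
  assumes lay: "layered X \<L> s Xs L" and once: "meet_once X \<L>" and A: "A \<in> \<L>"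
  shows "card (X \<inter> A) \<le> s"
proof (cases "\<exists>i<s. A = L i")
  case True
  then obtain i where i: "i < s" "A = L i" by blast
  have "(\<Sum>j<s. card (Xs j \<inter> L i)) \<le> (\<Sum>j<s. if j < i then 0 else if j = i then Suc i else 1)"
    using card_layer_line_le[OF lay once i(1)] by (intro sum_mono) simp
  then show ?thesis using i by (simp add: card_layered_line[OF lay] sum_layer_bounds)
next
  case False
  then have "(\<Sum>j<s. card (Xs j \<inter> A)) \<le> (\<Sum>j<s. 1)"
    using card_layer_line_le_1[OF lay once A] by (intro sum_mono) simp
  then show ?thesis by (simp add: card_layered_line[OF lay])
qed

text \<open>Equality in the count layer by layer. A line different from all \<open>L i\<close> meets
  each layer in at most one point, hence in exactly one, and so contains the singleton layer: then
  the index is 0.\<close>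

lemma rich_line_layers:
  assumes lay: "layered X \<L> s Xs L" and once: "meet_once X \<L>" and A: "A \<in> \<L>"
    and rich: "card (X \<inter> A) = s" and s: "0 < s"
  shows "\<exists>i<s. (\<forall>j<i. Xs j \<inter> A = {}) \<and> Xs i \<subseteq> A \<and> (\<forall>j. i < j \<longrightarrow> j < s \<longrightarrow> card (Xs j \<inter> A) = 1)"
proof (cases "\<exists>i<s. A = L i")
  case True
  then obtain i where i: "i < s" "A = L i" by blast
  let ?g = "\<lambda>j. if j < i then 0 else if j = i then Suc i else 1"
  have "card (Xs j \<inter> A) = 1" if "i < j" "j < s" for j
  proof -
    have "(\<Sum>j<s. card (Xs j \<inter> L i)) = sum ?g {..<s}"
      using rich i by (simp add: card_layered_line[OF lay] sum_layer_bounds)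
    then have "card (Xs j \<inter> L i) = ?g j"
      using card_layer_line_le[OF lay once i(1)] that
      by (intro sum_mono_inv[of "\<lambda>j. card (Xs j \<inter> L i)" "{..<s}" ?g j]) (simp_all only: lessThan_iff finite_lessThan)
    then show ?thesis using that i by simp
  qed
  then show ?thesis using i layeredD(5,6)[OF lay i(1)] by (intro exI[of _ i]) auto
next
  case False
  have one: "card (Xs j \<inter> A) = 1" if "j < s" for j
  proof -
    have "(\<Sum>j<s. card (Xs j \<inter> A)) = (\<Sum>j<s. 1)"
      using rich by (simp add: card_layered_line[OF lay])
    then show ?thesis
      using card_layer_line_le_1[OF lay once A] that False
      by (intro sum_mono_inv[of "\<lambda>j. card (Xs j \<inter> A)" "{..<s}" "\<lambda>j. 1" j]) auto
  qed
  have "Xs 0 \<inter> A = Xs 0"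
    using one[OF s] layeredD(2,3)[OF lay s] by (intro card_subset_eq) auto
  then have "Xs 0 \<subseteq> A" by blast
  then show ?thesis using one s by (intro exI[of _ 0]) simp
qed

text \<open>The line swallows layer \<open>i\<close>, takes one point from each later layer and none
  from the earlier ones. The later layers shrink by one and so close the gap in the sizes;
  \<open>?u\<close> renumbers by skipping \<open>i\<close>.\<close>

lemma layered_minus_rich_line:
  assumes lay: "layered X \<L> (Suc s) Xs L" and once: "meet_once X \<L>" and A: "A \<in> \<L>"
    and rich: "card (X \<inter> A) = Suc s"
  shows "\<exists>Xs L. layered (X - A) \<L> s Xs L"
proof -
  obtain i where i: "i < Suc s" "\<forall>j<i. Xs j \<inter> A = {}" "Xs i \<subseteq> A" "\<forall>j. i < j \<longrightarrow> j < Suc s \<longrightarrow> card (Xs j \<inter> A) = 1"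
    using rich_line_layers[OF lay once A rich] by auto
  let ?u = "\<lambda>j. if j < i then j else Suc j"
  have "layered (X - A) \<L> s (\<lambda>j. Xs (?u j) - A) (\<lambda>j. L (?u j))"
    unfolding layered_def
  proof (intro conjI allI impI)
    show "X - A = (\<Union>j<s. Xs (?u j) - A)"
    proof (intro equalityI subsetI)
      fix x assume x: "x \<in> X - A"
      then obtain k where k: "k < Suc s" "x \<in> Xs k" using layeredD(1)[OF lay] by blast
      have "k \<noteq> i" using i(3) k x by blast
      then consider "k < i" | "i < k" by linarith
      then show "x \<in> (\<Union>j<s. Xs (?u j) - A)"
      proof cases
        case 1
        then show ?thesis using k x i(1) by (intro UN_I[of k]) auto
      next
        case 2
        then show ?thesis using k x by (intro UN_I[of "k - 1"]) auto
      qed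
    next
      fix x assume "x \<in> (\<Union>j<s. Xs (?u j) - A)"
      then obtain j where "j < s" "x \<in> Xs (?u j)" "x \<notin> A" by blast
      moreover have "?u j < Suc s" using \<open>j < s\<close> by simp
      ultimately show "x \<in> X - A" using layeredD(8)[OF lay] by blast
    qed
  next
    fix j assume j: "j < s"
    have "card (Xs (?u j) - A) = card (Xs (?u j)) - card (Xs (?u j) \<inter> A)"
      using layeredD(3)[OF lay, of "?u j"] j by (intro card_Diff_subset_Int) auto
    then show "card (Xs (?u j) - A) = Suc j"
      using layeredD(2)[OF lay, of "?u j"] i(2,4) j by auto
    show "L (?u j) \<in> \<L>" "Xs (?u j) - A \<subseteq> L (?u j)"
      using layeredD(4,5)[OF lay, of "?u j"] j by auto
    fix k assume "k < j"
    then show "L (?u j) \<inter> (Xs (?u k) - A) = {}"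
      using layeredD(6)[OF lay, of "?u j" "?u k"] j by auto
  qed
  then show ?thesis by blast
qed

text \<open>Remove the points of one line \<open>A\<close> of \<open>R\<close>. Any other line of
  \<open>R\<close> loses at most one point, so it keeps the maximal number in the smaller
  configuration and induction applies. Then \<open>A\<close> returns as the last layer with all its
  points; it avoids the others because they lie in \<open>X - A\<close>.\<close>

lemma rich_lines_on_top:
  assumes "layered X \<L> s Xs L" "meet_once X \<L>" "R \<subseteq> \<L>" "finite R" "card R \<le> s"
    and "\<And>A. A \<in> R \<Longrightarrow> card (X \<inter> A) = s"
  shows "\<exists>Xs L. layered X \<L> s Xs L \<and> L ` {s - card R..<s} = R"
  using assms
proof (induction "card R" arbitrary: X s Xs L R)
  case 0
  then show ?case by auto
next
  case (Suc r)
  obtain A where A: "A \<in> R" using Suc.hyps(2) by fastforce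
  obtain s' where s: "s = Suc s'" using Suc.hyps(2) Suc.prems(5) by (cases s) auto
  let ?R = "R - {A}"
  have rich: "card (X \<inter> A) = Suc s'" using Suc.prems(6)[OF A] s by simp
  have R: "card ?R = r" using Suc.hyps(2) A Suc.prems(4) by simp
  obtain Xs' L' where lay: "layered (X - A) \<L> s' Xs' L'"
    using layered_minus_rich_line[OF Suc.prems(1)[unfolded s] Suc.prems(2) _ rich] A Suc.prems(3) by blast
  have once: "meet_once (X - A) \<L>" using Suc.prems(2) unfolding meet_once_def by blast
  have rich': "card ((X - A) \<inter> B) = s'" if B: "B \<in> ?R" for B
  proof -
    have fin: "finite X" by (rule layeredD(7)[OF Suc.prems(1)])
    have "card (X \<inter> A \<inter> B) \<le> 1"
      using meet_once_card_le[OF Suc.prems(2) fin, of A B] A B Suc.prems(3) by blast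
    moreover have "X \<inter> B = (X \<inter> A \<inter> B) \<union> ((X - A) \<inter> B)" by blast
    then have "card (X \<inter> B) \<le> card (X \<inter> A \<inter> B) + card ((X - A) \<inter> B)"
      by (metis card_Un_le)
    moreover have "card (X \<inter> B) = Suc s'" using Suc.prems(6)[of B] B s by simp
    moreover have "card ((X - A) \<inter> B) \<le> s'" using card_line_le[OF lay once] B Suc.prems(3) by blast
    ultimately show ?thesis by linarith
  qed
  have "\<exists>Ys M. layered (X - A) \<L> s' Ys M \<and> M ` {s' - card ?R..<s'} = ?R"
    by (rule Suc.hyps(1)[OF R[symmetric] lay once]) (use rich' R Suc.prems Suc.hyps(2) s in auto)
  then obtain Ys M where Y: "layered (X - A) \<L> s' Ys M" "M ` {s' - r..<s'} = ?R"
    using R by auto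
  let ?Ys = "Ys(s' := X \<inter> A)" and ?M = "M(s' := A)"
  have "layered X \<L> s ?Ys ?M"
    unfolding layered_def
  proof (intro conjI allI impI)
    have "X = (X - A) \<union> (X \<inter> A)" by blast
    then show "X = (\<Union>i<s. ?Ys i)"
      using layeredD(1)[OF Y(1)] by (auto simp: s lessThan_Suc)
  next
    fix i assume i: "i < s"
    show "card (?Ys i) = Suc i" "?M i \<in> \<L>" "?Ys i \<subseteq> ?M i"
      using i s rich layeredD(2,4,5)[OF Y(1), of i] A Suc.prems(3) by (auto simp: less_Suc_eq)
    fix j assume "j < i"
    then show "?M i \<inter> ?Ys j = {}"
      using i s layeredD(6)[OF Y(1), of i j] layeredD(8)[OF Y(1), of j] by (auto simp: less_Suc_eq)
  qed
  moreover have "?M ` {s - card R..<s} = R"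
  proof -
    have "{s - card R..<s} = insert s' {s' - r..<s'}"
      using Suc.hyps(2)[symmetric] s Suc.prems(5) by auto
    moreover have "?M ` {s' - r..<s'} = M ` {s' - r..<s'}" by (intro image_cong) auto
    ultimately show ?thesis using Y(2) A by (simp only: image_insert fun_upd_same insert_Diff)
  qed
  ultimately show ?case by blast
qed

text \<open>The points of \<open>L i\<close> are the \<open>Suc i\<close> points of layer
  \<open>i\<close> and points of later layers. \<open>N\<close> is \<open>s\<close> or
  \<open>s - 1\<close> in the applications, and \<open>k\<close> bounds the number of later points;
  it is given by an equation to keep truncated subtraction out of the estimates.\<close>

lemma sum_line_le:
  fixes n :: "'p \<Rightarrow> nat"
  assumes lay: "layered X \<L> s Xs L" and i: "i < s" and N: "card (X \<inter> L i) \<le> N"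
    and u: "\<And>p. p \<in> Xs i \<Longrightarrow> n p \<le> u" and v: "\<And>j p. i < j \<Longrightarrow> j < s \<Longrightarrow> p \<in> Xs j \<Longrightarrow> n p \<le> v"
  shows "\<exists>k. N = Suc i + k \<and> (\<Sum>p\<in>X \<inter> L i. n p) \<le> Suc i * u + k * v"
proof -
  let ?A = "X \<inter> L i"
  have sub: "Xs i \<subseteq> ?A" and fin: "finite ?A" using layeredD(5,7,8)[OF lay] i by auto
  have c: "card (?A - Xs i) = card ?A - Suc i" "Suc i \<le> card ?A"
    using card_Diff_subset[OF _ sub] layeredD(2,3)[OF lay i] card_mono[OF fin sub] by auto
  have "n p \<le> v" if p: "p \<in> ?A - Xs i" for p
  proof -
    obtain j where j: "j < s" "p \<in> Xs j" using p layeredD(1)[OF lay] by blast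
    then have "i < j" using p layeredD(6)[OF lay i, of j] by (cases i j rule: linorder_cases) auto
    then show ?thesis using v j by blast
  qed
  then have "(\<Sum>p\<in>?A - Xs i. n p) \<le> (N - Suc i) * v"
  proof -
    assume "\<And>p. p \<in> ?A - Xs i \<Longrightarrow> n p \<le> v"
    then have "(\<Sum>p\<in>?A - Xs i. n p) \<le> card (?A - Xs i) * v"
      using sum_bounded_above[of "?A - Xs i" n v] by simp
    also have "\<dots> \<le> (N - Suc i) * v" using c N by (intro mult_le_mono1) simp
    finally show ?thesis .
  qed
  moreover have "(\<Sum>p\<in>Xs i. n p) \<le> Suc i * u"
    using sum_bounded_above[of "Xs i" n u] u layeredD(2)[OF lay i] by simp
  moreover have "(\<Sum>p\<in>?A. n p) = (\<Sum>p\<in>?A - Xs i. n p) + (\<Sum>p\<in>Xs i. n p)"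
    using sum.subset_diff[OF sub fin] .
  ultimately show ?thesis using c N by (intro exI[of _ "N - Suc i"]) linarith
qed

section \<open>The order in which lines are split off\<close>

text \<open>All that the splitting argument uses about the defect. The family of lines is a
  parameter because one chart has to serve all its members, which is arranged for finite
  families.\<close>

locale line_defect =
  fixes X :: "'p set" and \<L> :: "'p set set" and \<delta> :: "('p \<Rightarrow> nat) \<Rightarrow> nat \<Rightarrow> int"
  assumes nonneg: "0 \<le> \<delta> n d"
    and zero: "(\<And>p. p \<in> X \<Longrightarrow> n p = 0) \<Longrightarrow> \<delta> n d = 0"
    and step_le: "A \<in> \<L> \<Longrightarrow> 0 < d \<Longrightarrow> (\<Sum>p\<in>X \<inter> A. n p) \<le> d \<Longrightarrow> \<delta> n d \<le> \<delta> (\<lambda>p. n p - of_bool (p \<in> A)) (d - 1)"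
    and step_eq: "A \<in> \<L> \<Longrightarrow> 0 < d \<Longrightarrow> d \<le> (\<Sum>p\<in>X \<inter> A. n p) \<Longrightarrow>
      \<delta> n d = \<delta> (\<lambda>p. n p - of_bool (p \<in> A)) (d - 1) + (int (\<Sum>p\<in>X \<inter> A. n p) - int d)"
    and once: "meet_once X \<L>"
begin

lemma step_zero:
  assumes "A \<in> \<L>" "(\<Sum>p\<in>X \<inter> A. n p) \<le> Suc d" "\<delta> (\<lambda>p. n p - of_bool (p \<in> A)) d = 0"
  shows "\<delta> n (Suc d) = 0"
  using step_le[of A "Suc d" n] nonneg[of n "Suc d"] assms by simp

context
  fixes s Xs L
  assumes lay: "layered X \<L> s Xs L"
begin

lemma layer_reduced_le:
  assumes "i < s" "p \<in> Xs i" "n p \<le> Suc u"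
  shows "n p - of_bool (p \<in> L i) \<le> u"
  using assms layeredD(5)[OF lay] by auto

lemma reduced_le: "n p \<le> u \<Longrightarrow> n p - of_bool (p \<in> A) \<le> (u :: nat)"
  by simp

lemma defect_uniform:
  assumes "\<And>p. p \<in> X \<Longrightarrow> n p \<le> M"
  shows "\<delta> n (M * s) = 0"
  using assms
proof (induction M arbitrary: n)
  case 0
  then show ?case using zero by simp
next
  case (Suc M)
  \<comment> \<open>The state within a round: the layers below \<open>i\<close> still await their
    line. On the next line the bound is \<open>(i + 1)(M + 1) + (s - i - 1) M\<close>, which equals
    M s + i + 1, exactly the current degree parameter.\<close>
  have "\<delta> n (M * s + i) = 0"
    if "i \<le> s" "\<And>j p. j < i \<Longrightarrow> p \<in> Xs j \<Longrightarrow> n p \<le> Suc M" "\<And>j p. i \<le> j \<Longrightarrow> j < s \<Longrightarrow> p \<in> Xs j \<Longrightarrow> n p \<le> M" for n i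
    using that
  proof (induction i arbitrary: n)
    case 0
    have "n p \<le> M" if "p \<in> X" for p using that 0(3) layeredD(1)[OF lay] by blast
    then show ?case using Suc.IH by simp
  next
    case (Suc i)
    have i: "i < s" using Suc.prems by simp
    have u: "n p \<le> Suc M" if "p \<in> Xs i" for p using Suc.prems(2)[of i p] that by simp
    have v: "n p \<le> M" if "i < j" "j < s" "p \<in> Xs j" for j p using Suc.prems(3)[of j p] that by simp
    have "\<exists>k. s = Suc i + k \<and> (\<Sum>p\<in>X \<inter> L i. n p) \<le> Suc i * Suc M + k * M"
      by (rule sum_line_le[OF lay i card_line_le[OF lay once layeredD(4)[OF lay i]]]) (fact u, fact v)
    then obtain k where k: "s = Suc i + k" "(\<Sum>p\<in>X \<inter> L i. n p) \<le> Suc i * Suc M + k * M" by blast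
    have "\<delta> (\<lambda>p. n p - of_bool (p \<in> L i)) (M * s + i) = 0"
    proof (rule Suc.IH)
      fix j p assume "i \<le> j" "j < s" "p \<in> Xs j"
      then show "n p - of_bool (p \<in> L i) \<le> M"
        using layer_reduced_le[OF i, of p n M] Suc.prems(2)[of i p] Suc.prems(3)[of j p] reduced_le
        by (cases "i = j") auto
    next
      fix j p assume "j < i" "p \<in> Xs j"
      then show "n p - of_bool (p \<in> L i) \<le> Suc M" using Suc.prems(2)[of j p] by simp
    qed (use i in simp)
    moreover have "Suc i * Suc M + k * M = Suc (M * s + i)" using k(1) by (simp add: algebra_simps)
    ultimately show ?case using step_zero[OF layeredD(4)[OF lay i], of n "M * s + i"] k(2) by simp
  qed
  from this[of s n] show ?case using Suc.prems layeredD(8)[OF lay] by (auto simp: add.commute)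
qed

context
  fixes M r :: nat and w p q :: 'p and H1 H2 :: "'p set"
  assumes M: "2 \<le> M" and s: "2 \<le> s" and r: "r < s"
    and poor: "\<And>i. i < s - r \<Longrightarrow> card (X \<inter> L i) < s"
    and Xs01: "Xs 0 = {w}" "Xs 1 = {p, q}"
    and H: "H1 \<in> \<L>" "H2 \<in> \<L>" "w \<in> H1" "p \<in> H1" "w \<in> H2" "q \<in> H2"
      "card (X \<inter> H1) < s" "card (X \<inter> H2) < s"
begin

text \<open>The pencil of lines through \<open>w\<close> clears the excess on \<open>w\<close>, \<open>p\<close>, \<open>q\<close> with one line
  fewer than the lines of the configuration would need.\<close>

lemma defect_pencil:
  assumes "n w \<le> M + 2" "n p \<le> M + 1" "n q \<le> M + 1" "\<And>j x. 2 \<le> j \<Longrightarrow> j < s \<Longrightarrow> x \<in> Xs j \<Longrightarrow> n x \<le> M"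
  shows "\<delta> n (M * s + 2) = 0"
proof -
  have fin: "finite X" by (rule layeredD(7)[OF lay])
  have cases: "x = w \<or> x = p \<or> x = q \<or> (\<exists>j. 2 \<le> j \<and> j < s \<and> x \<in> Xs j)" if x: "x \<in> X" for x
  proof -
    obtain j where j: "j < s" "x \<in> Xs j" using x layeredD(1)[OF lay] by blast
    consider "j = 0" | "j = 1" | "2 \<le> j" by linarith
    then show ?thesis using Xs01 j by cases auto
  qed
  have neq: "p \<noteq> w" "q \<noteq> w" using layered_disjoint[OF lay, of 0 1] Xs01 s by auto
  have X_le: "n x \<le> M + of_bool (x = w) * 2 + of_bool (x = p) + of_bool (x = q)" if x: "x \<in> X" for x
    using cases[OF x] assms by (auto simp: trans_le_add1)
  define n1 where "n1 = (\<lambda>x. n x - of_bool (x \<in> H1))"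
  have n1_le: "n1 x \<le> M + of_bool (x = w) + of_bool (x = q)" if x: "x \<in> X" for x
    using X_le[OF x] H(3,4) neq by (cases "x = w"; cases "x = p") (auto simp: n1_def)
  define n2 where "n2 = (\<lambda>x. n1 x - of_bool (x \<in> H2))"
  have n2_le: "n2 x \<le> M" if x: "x \<in> X" for x
    using n1_le[OF x] H(5,6) neq by (cases "x = w"; cases "x = q") (auto simp: n2_def)
  have sum_of_bool: "(\<Sum>x\<in>X \<inter> A. of_bool (x = y)) \<le> (1 :: nat)" for A y
    using fin by (simp add: of_bool_def)
  \<comment> \<open>A line with fewer than \<open>s\<close> points leaves a slack of
    \<open>M\<close>. On \<open>H1\<close> the total excess 2 + 1 + 1 has to fit into this slack
    together with the 2 in M s + 2, which is where \<open>2 <= M\<close> enters.\<close>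
  have MM: "card (X \<inter> A) * M + M \<le> M * s" if "card (X \<inter> A) < s" for A
    using mult_le_mono1[of "Suc (card (X \<inter> A))" s M] that by (simp add: algebra_simps)
  have "(\<Sum>x\<in>X \<inter> H1. n x) \<le> (\<Sum>x\<in>X \<inter> H1. M + of_bool (x = w) * 2 + of_bool (x = p) + of_bool (x = q))"
    using X_le by (intro sum_mono) auto
  also have "\<dots> \<le> card (X \<inter> H1) * M + 1 * 2 + 1 + 1"
    unfolding sum.distrib sum_distrib_right[symmetric]
    by (intro add_mono mult_le_mono1 sum_of_bool) simp
  also have "\<dots> \<le> Suc (M * s + 1)" using MM[OF H(7)] M by linarith
  finally have 1: "(\<Sum>x\<in>X \<inter> H1. n x) \<le> Suc (M * s + 1)" .
  have "(\<Sum>x\<in>X \<inter> H2. n1 x) \<le> (\<Sum>x\<in>X \<inter> H2. M + of_bool (x = w) + of_bool (x = q))"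
    using n1_le by (intro sum_mono) auto
  also have "\<dots> \<le> card (X \<inter> H2) * M + 1 + 1"
    unfolding sum.distrib by (intro add_mono sum_of_bool) simp
  also have "\<dots> \<le> Suc (M * s)" using MM[OF H(8)] M by linarith
  finally have 2: "(\<Sum>x\<in>X \<inter> H2. n1 x) \<le> Suc (M * s)" .
  have "\<delta> n2 (M * s) = 0" by (rule defect_uniform[OF n2_le])
  then have "\<delta> n1 (Suc (M * s)) = 0" unfolding n2_def by (rule step_zero[OF H(2) 2])
  then have "\<delta> n (Suc (M * s + 1)) = 0" unfolding n1_def by (intro step_zero[OF H(1) 1]) simp
  then show ?thesis by simp
qed

text \<open>Each \<open>L j\<close> with 2 <= j < i is split off twice, \<open>L 1\<close> only
  once, and the pencil accounts for two lines; hence \<open>2 * i - 1\<close>. In the first of two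
  passes over a line the multiplicity \<open>M + 2\<close> on its layer is paid for by the missing
  point, in the second the bound of \<open>s\<close> points suffices.\<close>

lemma defect_poor_lines:
  assumes "2 \<le> i" "i \<le> s - r" "\<And>j x. j < i \<Longrightarrow> x \<in> Xs j \<Longrightarrow> n x \<le> M + 2"
    "\<And>j x. i \<le> j \<Longrightarrow> j < s \<Longrightarrow> x \<in> Xs j \<Longrightarrow> n x \<le> M"
  shows "\<delta> n (M * s + 2 * i - 1) = 0"
  using assms
proof (induction i arbitrary: n rule: dec_induct)
  case base
  have i: "1 < s" using s by simp
  have "card (X \<inter> L 1) \<le> s - 1" using poor[of 1] base by simp
  moreover have "n p \<le> M + 2" if "p \<in> Xs 1" for p using base(2)[of 1 p] that by simp
  moreover have "n p \<le> M" if "1 < j" "j < s" "p \<in> Xs j" for j p using base(3)[of j p] that by simp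
  ultimately have "\<exists>k. s - 1 = Suc 1 + k \<and> (\<Sum>p\<in>X \<inter> L 1. n p) \<le> Suc 1 * (M + 2) + k * M"
    by (rule sum_line_le[OF lay i])
  then obtain k where k: "s - 1 = Suc 1 + k" "(\<Sum>p\<in>X \<inter> L 1. n p) \<le> Suc 1 * (M + 2) + k * M" by blast
  have "s = k + 3" using k(1) by simp
  then have "Suc 1 * (M + 2) + k * M \<le> Suc (M * s + 2)" using M by (simp add: algebra_simps)
  moreover have "\<delta> (\<lambda>p. n p - of_bool (p \<in> L 1)) (M * s + 2) = 0"
  proof (rule defect_pencil)
    show "n p - of_bool (p \<in> L 1) \<le> M + 1" "n q - of_bool (q \<in> L 1) \<le> M + 1"
      using layer_reduced_le[OF i, of _ n "M + 1"] base(2)[of 1] Xs01 by auto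
    show "n x - of_bool (x \<in> L 1) \<le> M" if "2 \<le> j" "j < s" "x \<in> Xs j" for j x
      using base(3)[of j x] that by simp
  qed (use base(2)[of 0 w] Xs01 in auto)
  ultimately have "\<delta> n (Suc (M * s + 2)) = 0"
    using k(2) by (intro step_zero[OF layeredD(4)[OF lay i]]) auto
  then show ?case by (simp add: eval_nat_numeral)
next
  case (step i)
  have i: "i < s" and le: "card (X \<inter> L i) \<le> s - 1" using step.prems poor[of i] by auto
  define n1 where "n1 = (\<lambda>x. n x - of_bool (x \<in> L i))"
  define n2 where "n2 = (\<lambda>x. n1 x - of_bool (x \<in> L i))"
  have n1: "n1 x \<le> M + 1" if "x \<in> Xs i" for x
    using layer_reduced_le[OF i that, of n "M + 1"] step.prems(2)[of i x] that by (simp add: n1_def)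
  have n1': "n1 x \<le> M" if "i < j" "j < s" "x \<in> Xs j" for j x
    using step.prems(3)[of j x] that by (simp add: n1_def)
  have n2: "n2 x \<le> M" if "i \<le> j" "j < s" "x \<in> Xs j" for j x
    using layer_reduced_le[OF i, of x n1 M] n1[of x] n1'[of j x] that reduced_le[of n1 x M]
    by (cases "i = j") (auto simp: n2_def)
    have u: "n p \<le> M + 2" if "p \<in> Xs i" for p using step.prems(2)[of i p] that by simp
    have v: "n p \<le> M" if "i < j" "j < s" "p \<in> Xs j" for j p using step.prems(3)[of j p] that by simp
  have "\<exists>k. s - 1 = Suc i + k \<and> (\<Sum>p\<in>X \<inter> L i. n p) \<le> Suc i * (M + 2) + k * M"
    by (rule sum_line_le[OF lay i le]) (fact u, fact v)
  then obtain k where k: "s - 1 = Suc i + k" "(\<Sum>p\<in>X \<inter> L i. n p) \<le> Suc i * (M + 2) + k * M" by blast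
  have "\<exists>k. s = Suc i + k \<and> (\<Sum>p\<in>X \<inter> L i. n1 p) \<le> Suc i * (M + 1) + k * M"
    by (rule sum_line_le[OF lay i card_line_le[OF lay once layeredD(4)[OF lay i]]]) (fact n1, fact n1')
  then obtain k' where k': "s = Suc i + k'" "(\<Sum>p\<in>X \<inter> L i. n1 p) \<le> Suc i * (M + 1) + k' * M" by blast
  have s1: "s = i + k + 2" and "k' = Suc k" using k(1) k'(1) by auto
  then have 2: "(\<Sum>p\<in>X \<inter> L i. n1 p) \<le> Suc (M * s + 2 * i - 1)"
    using k'(2) step.hyps by (simp add: algebra_simps)
  have 1: "(\<Sum>p\<in>X \<inter> L i. n p) \<le> Suc (Suc (M * s + 2 * i - 1))"
    using k(2) s1 M step.hyps by (simp add: algebra_simps)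
  have "\<delta> n2 (M * s + 2 * i - 1) = 0"
  proof (rule step.IH)
    fix j x assume "j < i" "x \<in> Xs j"
    then show "n2 x \<le> M + 2" using step.prems(2)[of j x] by (simp add: n1_def n2_def)
  qed (use n2 step.prems(1) in auto)
  then have "\<delta> n1 (Suc (M * s + 2 * i - 1)) = 0"
    unfolding n2_def by (rule step_zero[OF layeredD(4)[OF lay i] 2])
  then have "\<delta> n (Suc (Suc (M * s + 2 * i - 1))) = 0"
    unfolding n1_def by (rule step_zero[OF layeredD(4)[OF lay i] 1])
  moreover have "Suc (Suc (M * s + 2 * i - 1)) = M * s + 2 * Suc i - 1" using step.hyps by simp
  ultimately show ?case by simp
qed

text \<open>The \<open>max\<close> keeps \<open>L 1\<close> out of this pass even if it has
  \<open>s\<close> points. In that case s - r = 1 and \<open>L 1\<close> has been split off once, so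
  \<open>p\<close> and \<open>q\<close> already have multiplicity at most M + 1 and the pencil
  applies at once.\<close>

lemma defect_rich_lines_again:
  assumes "max 2 (s - r) \<le> i" "i \<le> s" "\<And>j x. j < s - r \<Longrightarrow> x \<in> Xs j \<Longrightarrow> n x \<le> M + 2"
    "\<And>j x. s - r \<le> j \<Longrightarrow> j < i \<Longrightarrow> x \<in> Xs j \<Longrightarrow> n x \<le> M + 1"
    "\<And>j x. i \<le> j \<Longrightarrow> j < s \<Longrightarrow> x \<in> Xs j \<Longrightarrow> n x \<le> M"
  shows "\<delta> n (M * s + (s - r) + i - 1) = 0"
  using assms
proof (induction i arbitrary: n rule: dec_induct)
  case base
  show ?case
  proof (cases "2 \<le> s - r")
    case True
    then have "\<delta> n (M * s + 2 * (s - r) - 1) = 0"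
      using base by (intro defect_poor_lines) auto
    then show ?thesis using True by (simp add: max_def mult_2 add.assoc)
  next
    case False
    then have sr: "s - r = 1" using r by linarith
    have "\<delta> n (M * s + 2) = 0"
    proof (rule defect_pencil)
      show "n x \<le> M" if "2 \<le> j" "j < s" "x \<in> Xs j" for j x using base(4)[of j x] that sr by simp
    qed (use base(2)[of 0] base(3)[of 1] Xs01 sr in auto)
    then show ?thesis using sr by simp
  qed
next
  case (step i)
  have i: "i < s" using step.prems by simp
    have u: "n p \<le> M + 1" if "p \<in> Xs i" for p using step.prems(3)[of i p] step.hyps that by simp
    have v: "n p \<le> M" if "i < j" "j < s" "p \<in> Xs j" for j p using step.prems(4)[of j p] that by simp
  have "\<exists>k. s = Suc i + k \<and> (\<Sum>p\<in>X \<inter> L i. n p) \<le> Suc i * (M + 1) + k * M"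
    by (rule sum_line_le[OF lay i card_line_le[OF lay once layeredD(4)[OF lay i]]]) (fact u, fact v)
  then obtain k where k: "s = Suc i + k" "(\<Sum>p\<in>X \<inter> L i. n p) \<le> Suc i * (M + 1) + k * M" by blast
  have "Suc i * (M + 1) + k * M = M * s + Suc i" using k(1) by (simp add: algebra_simps)
  then have 1: "(\<Sum>p\<in>X \<inter> L i. n p) \<le> Suc (M * s + (s - r) + i - 1)" using k(2) r by linarith
  have "\<delta> (\<lambda>x. n x - of_bool (x \<in> L i)) (M * s + (s - r) + i - 1) = 0"
  proof (rule step.IH)
    fix j x assume "i \<le> j" "j < s" "x \<in> Xs j"
    then show "n x - of_bool (x \<in> L i) \<le> M"
      using layer_reduced_le[OF i, of x n M] step.prems(3)[of i x] step.prems(4)[of j x] step.hyps reduced_le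
      by (cases "i = j") auto
  next
    fix j x assume "j < s - r" "x \<in> Xs j"
    then show "n x - of_bool (x \<in> L i) \<le> M + 2" using step.prems(2)[of j x] by simp
  next
    fix j x assume "s - r \<le> j" "j < i" "x \<in> Xs j"
    then show "n x - of_bool (x \<in> L i) \<le> M + 1" using step.prems(3)[of j x] by simp
  qed (use i in simp)
  then have "\<delta> n (Suc (M * s + (s - r) + i - 1)) = 0"
    by (rule step_zero[OF layeredD(4)[OF lay i] 1])
  moreover have "Suc (M * s + (s - r) + i - 1) = M * s + (s - r) + Suc i - 1" using r by linarith
  ultimately show ?case by (simp only:)
qed

text \<open>After \<open>e\<close> lines the multiplicities on the next one sum to exactly
  \<open>(M + 2) * s - e\<close>, one more than the degree parameter, so each line contributes 1.
  The sum is not smaller because each earlier line meets it in at most one point, and not larger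
  because each of its \<open>e\<close> points in later layers lies on an earlier line.\<close>

lemma defect_rich_lines_once:
  assumes rich: "\<And>i. s - r \<le> i \<Longrightarrow> i < s \<Longrightarrow> card (X \<inter> L i) = s" and e: "e \<le> r"
  shows "\<delta> (\<lambda>_. M + 2) ((M + 2) * s - 1)
    = \<delta> (\<lambda>x. M + 2 - (\<Sum>j\<in>{s - e..<s}. of_bool (x \<in> L j))) ((M + 2) * s - 1 - e) + int e"
  using e
proof (induction e)
  case (Suc e)
  define i where "i = s - Suc e"
  have i: "i < s" "s - r \<le> i" and es: "e + Suc i = s" "s - e = Suc i" using Suc.prems r by (auto simp: i_def)
  define n where "n = (\<lambda>x. M + 2 - (\<Sum>j\<in>{s - e..<s}. of_bool (x \<in> L j) :: nat))"
  let ?A = "X \<inter> L i" and ?d = "(M + 2) * s - 1 - e"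
  have fin: "finite ?A" using layeredD(7)[OF lay] by simp
  have card: "card ?A = s" using rich i by simp
  have "(\<Sum>x\<in>?A. n x) \<le> Suc i * (M + 2) + e * (M + 1)"
  proof -
    have "n x \<le> M + 1" if "i < j" "j < s" "x \<in> Xs j" for j x
    proof -
      have "1 = (\<Sum>j\<in>{j}. of_bool (x \<in> L j) :: nat)" using layeredD(5)[OF lay, of j] that by auto
      also have "\<dots> \<le> (\<Sum>j\<in>{s - e..<s}. of_bool (x \<in> L j))"
        using that es by (intro sum_mono2) auto
      finally show ?thesis by (simp add: n_def)
    qed
    moreover have "n x \<le> M + 2" for x by (simp add: n_def)
    ultimately have "\<exists>k. s = Suc i + k \<and> (\<Sum>x\<in>?A. n x) \<le> Suc i * (M + 2) + k * (M + 1)"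
      by (intro sum_line_le[OF lay i(1) eq_refl[OF card]]) auto
    then obtain k where "s = Suc i + k" "(\<Sum>x\<in>?A. n x) \<le> Suc i * (M + 2) + k * (M + 1)" by blast
    moreover from this(1) es(1) have "k = e" by linarith
    ultimately show ?thesis by simp
  qed
  moreover have "s * (M + 2) \<le> (\<Sum>x\<in>?A. n x) + e"
  proof -
    have "s * (M + 2) = (\<Sum>x\<in>?A. M + 2)" using card by simp
    also have "\<dots> \<le> (\<Sum>x\<in>?A. n x + (\<Sum>j\<in>{s - e..<s}. of_bool (x \<in> L j)))"
      by (intro sum_mono) (simp add: n_def)
    also have "\<dots> = (\<Sum>x\<in>?A. n x) + (\<Sum>j\<in>{s - e..<s}. \<Sum>x\<in>?A. of_bool (x \<in> L j))"
      by (simp only: sum.distrib sum.swap[of _ "{s - e..<s}"])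
    also have "(\<Sum>j\<in>{s - e..<s}. \<Sum>x\<in>?A. of_bool (x \<in> L j) :: nat) \<le> (\<Sum>j\<in>{s - e..<s}. 1)"
    proof (rule sum_mono)
      fix j assume j: "j \<in> {s - e..<s}"
      then have "L i \<noteq> L j" using layered_lines_distinct[OF lay i(1)] es by auto
      then have "card (?A \<inter> L j) \<le> 1"
        using j by (intro meet_once_card_le[OF once layeredD(7)[OF lay] layeredD(4)[OF lay i(1)] layeredD(4)[OF lay, of j]]) auto
      then show "(\<Sum>x\<in>?A. of_bool (x \<in> L j) :: nat) \<le> 1"
        using fin by (simp add: of_bool_def sum.If_cases)
    qed
    also have "\<dots> = e" using es by simp
    finally show ?thesis by simp
  qed
  moreover have "Suc i * (M + 2) + e * (M + 1) + e = s * (M + 2)"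
    unfolding es(1)[symmetric] by (simp add: algebra_simps)
  ultimately have sum: "(\<Sum>x\<in>?A. n x) + e = (M + 2) * s" by (simp add: mult.commute)
  have "e + 1 < (M + 2) * s"
  proof -
    have "2 * s \<le> (M + 2) * s" by (intro mult_le_mono1) simp
    then show ?thesis using Suc.prems r by linarith
  qed
  then have d: "0 < ?d" "(\<Sum>x\<in>?A. n x) = Suc ?d" using sum by linarith+
  have red: "(\<lambda>x. n x - of_bool (x \<in> L i)) = (\<lambda>x. M + 2 - (\<Sum>j\<in>{s - Suc e..<s}. of_bool (x \<in> L j)))"
  proof -
    have "{s - Suc e..<s} = insert i {s - e..<s}" using es by auto
    then show ?thesis using es by (auto simp: n_def)
  qed
  have "\<delta> n ?d = \<delta> (\<lambda>x. n x - of_bool (x \<in> L i)) (?d - 1) + 1"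
    using step_eq[OF layeredD(4)[OF lay i(1)] d(1), of n] d(2) by simp
  then show ?case using Suc.IH Suc.prems unfolding red n_def[symmetric] by simp
qed simp

lemma defect_rich:
  assumes rich: "\<And>i. s - r \<le> i \<Longrightarrow> i < s \<Longrightarrow> card (X \<inter> L i) = s"
  shows "\<delta> (\<lambda>_. M + 2) ((M + 2) * s - 1) = int r"
proof -
  let ?n = "\<lambda>x. M + 2 - (\<Sum>j\<in>{s - r..<s}. of_bool (x \<in> L j) :: nat)"
  have "?n x \<le> M + 1" if "s - r \<le> j" "j < s" "x \<in> Xs j" for j x
  proof -
    have "1 = (\<Sum>j\<in>{j}. of_bool (x \<in> L j) :: nat)" using layeredD(5)[OF lay, of j] that by auto
    also have "\<dots> \<le> (\<Sum>j\<in>{s - r..<s}. of_bool (x \<in> L j))"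
      using that by (intro sum_mono2) auto
    finally show ?thesis by simp
  qed
  then have "\<delta> ?n (M * s + (s - r) + s - 1) = 0"
    using s by (intro defect_rich_lines_again) auto
  moreover have "M * s + (s - r) + s - 1 = (M + 2) * s - 1 - r"
    using r by (simp add: algebra_simps)
  ultimately show ?thesis using defect_rich_lines_once[OF rich, of r] by simp
qed

end

end

end

section \<open>Generic charts\<close>

lemma infinite_UNIV_alg_closed_field: "infinite (UNIV :: 'k::alg_closed_field set)"
proof
  assume fin: "finite (UNIV :: 'k set)"
  let ?P = "\<Prod>c\<in>UNIV. [:-c, 1 :: 'k:]"
  have "degree ?P = card (UNIV :: 'k set)"
    by (subst degree_prod_eq_sum_degree) auto
  then have "degree ?P > 0" using fin by (simp add: card_gt_0_iff)
  then have "degree (?P + 1) > 0" by (subst degree_add_eq_left) auto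
  then obtain z where "poly (?P + 1) z = 0" using alg_closed_imp_poly_has_root by blast
  moreover have "poly ?P z = 0" using fin by (simp add: poly_prod)
  ultimately show False by simp
qed

lemma proportional_iff_cross_zero:
  fixes p q :: "'k::field \<times> 'k \<times> 'k"
  assumes "p = (p0, p1, p2)" "q = (q0, q1, q2)" "p \<noteq> 0" "q \<noteq> 0"
    "p1 * q2 = p2 * q1" "p2 * q0 = p0 * q2" "p0 * q1 = p1 * q0"
  shows "proportional p q"
proof -
  have ex: "proportional p q" if "q0 = c * p0" "q1 = c * p1" "q2 = c * p2" for c
    using that assms(1,2,4) unfolding proportional_def by (intro exI[of _ c]) (auto simp: zero_prod_def)
  consider "p0 \<noteq> 0" | "p1 \<noteq> 0" | "p2 \<noteq> 0" using assms(1,3) by (auto simp: zero_prod_def)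
  then show ?thesis
  proof cases
    case 1
    then show ?thesis using assms(5-7) by (intro ex[of "q0 / p0"]) (auto simp: field_simps)
  next
    case 2
    then show ?thesis using assms(5-7) by (intro ex[of "q1 / p1"]) (auto simp: field_simps)
  next
    case 3
    then show ?thesis using assms(5-7) by (intro ex[of "q2 / p2"]) (auto simp: field_simps)
  qed
qed

lemma line_proportional: "proportional h w \<Longrightarrow> line h = line w"
  by (auto simp: proportional_def line_def mult.assoc simp flip: distrib_left)

lemma lines_eq: "lines = line ` {h. h \<noteq> 0}"
  unfolding lines_def by blast

definition cross :: "'k::field \<times> 'k \<times> 'k \<Rightarrow> 'k \<times> 'k \<times> 'k \<Rightarrow> 'k \<times> 'k \<times> 'k" where
  "cross p q = (fst (snd p) * snd (snd q) - snd (snd p) * fst (snd q), snd (snd p) * fst q - fst p * snd (snd q),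
     fst p * fst (snd q) - fst (snd p) * fst q)"

lemma cross_nonzero: "p \<noteq> 0 \<Longrightarrow> q \<noteq> 0 \<Longrightarrow> \<not> proportional p q \<Longrightarrow> cross p q \<noteq> 0"
  using proportional_iff_cross_zero[of p "fst p" "fst (snd p)" "snd (snd p)" q "fst q" "fst (snd q)" "snd (snd q)"]
  by (auto simp: cross_def zero_prod_def)

lemma line_eq_cross:
  assumes pq: "p \<noteq> 0" "q \<noteq> 0" "\<not> proportional p q" and h: "h \<noteq> 0" "p \<in> line h" "q \<in> line h"
  shows "line h = line (cross p q)"
proof (rule line_proportional)
  obtain p0 p1 p2 q0 q1 q2 h0 h1 h2 where [simp]: "p = (p0, p1, p2)" "q = (q0, q1, q2)" "h = (h0, h1, h2)"
    by (metis prod.exhaust)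
  have p: "h0 * p0 + h1 * p1 + h2 * p2 = 0" and q: "h0 * q0 + h1 * q1 + h2 * q2 = 0"
    using h by (auto simp: line_def)
  show "proportional h (cross p q)"
  proof (rule proportional_iff_cross_zero)
    show "h = (h0, h1, h2)" "h \<noteq> 0" "cross p q \<noteq> 0" using cross_nonzero[OF pq] h by auto
    show "cross p q = (p1 * q2 - p2 * q1, p2 * q0 - p0 * q2, p0 * q1 - p1 * q0)"
      by (simp add: cross_def)
    show "h1 * (p0 * q1 - p1 * q0) = h2 * (p2 * q0 - p0 * q2)" using p q by algebra
    show "h2 * (p1 * q2 - p2 * q1) = h0 * (p0 * q1 - p1 * q0)" using p q by algebra
    show "h0 * (p2 * q0 - p0 * q2) = h1 * (p1 * q2 - p2 * q1)" using p q by algebra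
  qed
qed

lemma point_setD:
  assumes "point_set X" "p \<in> X" "q \<in> X" "p \<noteq> q"
  shows "p \<noteq> 0" "q \<noteq> 0" "\<not> proportional p q"
  using assms by (auto simp: point_set_def)

lemma meet_once_lines:
  assumes "point_set X"
  shows "meet_once X lines"
  unfolding meet_once_def
proof (intro ballI impI)
  fix A B p q assume *: "A \<in> lines" "B \<in> lines" "A \<noteq> B" "p \<in> X \<inter> A \<inter> B" "q \<in> X \<inter> A \<inter> B"
  then obtain h h' where "A = line h" "h \<noteq> 0" "B = line h'" "h' \<noteq> 0" unfolding lines_eq by blast
  then show "p = q" using line_eq_cross[of p q h] line_eq_cross[of p q h'] point_setD[OF assms, of p q] * by blast
qed

lemma line_through:
  assumes "point_set X" "p \<in> X" "q \<in> X" "p \<noteq> q"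
  shows "\<exists>A\<in>lines. p \<in> A \<and> q \<in> A"
proof
  show "line (cross p q) \<in> lines" using cross_nonzero[OF point_setD[OF assms]] unfolding lines_eq by blast
  show "p \<in> line (cross p q) \<and> q \<in> line (cross p q)"
    using point_setD(1,2)[OF assms] by (auto simp: line_def cross_def algebra_simps)
qed

text \<open>For each \<open>h\<close> the first condition excludes the roots of a nonzero polynomial
  of degree at most 2 in \<open>\<mu>\<close>; it says that (1, \<open>\<mu>\<close>,
  \<open>\<mu>\<^sup>2\<close>) is on none of the lines. As each point of \<open>X\<close> is on one
  of them, it is not proportional to this vector, so the second condition excludes the roots of a
  nonzero polynomial in \<open>\<nu>\<close>.\<close>

lemma generic_chart:
  fixes X \<A> :: "('k::alg_closed_field \<times> 'k \<times> 'k) set"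
  assumes X: "finite X" "0 \<notin> X" and \<A>: "finite \<A>" "0 \<notin> \<A>" and cover: "\<And>p. p \<in> X \<Longrightarrow> \<exists>h\<in>\<A>. p \<in> line h"
  shows "\<exists>\<mu> \<nu>. (\<forall>h\<in>\<A>. fst h + \<mu> * fst (snd h) + \<mu>\<^sup>2 * snd (snd h) \<noteq> 0) \<and>
    (\<forall>p\<in>X. (fst (snd p) - \<mu> * fst p) + \<nu> * (snd (snd p) - \<mu>\<^sup>2 * fst p) \<noteq> 0)"
proof -
  have "finite (\<Union>h\<in>\<A>. {x. poly [:fst h, fst (snd h), snd (snd h):] x = 0})"
    using \<A> by (intro finite_UN_I poly_roots_finite) (auto simp: zero_prod_def prod_eq_iff)
  then obtain \<mu> where "\<mu> \<notin> (\<Union>h\<in>\<A>. {x. poly [:fst h, fst (snd h), snd (snd h):] x = 0})"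
    using ex_new_if_finite[OF infinite_UNIV_alg_closed_field] by blast
  then have \<mu>: "fst h + \<mu> * fst (snd h) + \<mu>\<^sup>2 * snd (snd h) \<noteq> 0" if "h \<in> \<A>" for h
    using that by (auto simp: power2_eq_square algebra_simps)
  have "[:fst (snd p) - \<mu> * fst p, snd (snd p) - \<mu>\<^sup>2 * fst p:] \<noteq> 0" if p: "p \<in> X" for p
  proof
    assume "[:fst (snd p) - \<mu> * fst p, snd (snd p) - \<mu>\<^sup>2 * fst p:] = 0"
    then have eq: "fst (snd p) = \<mu> * fst p" "snd (snd p) = \<mu>\<^sup>2 * fst p" by auto
    obtain h where h: "h \<in> \<A>" "p \<in> line h" using cover[OF p] by blast
    have "fst p * (fst h + \<mu> * fst (snd h) + \<mu>\<^sup>2 * snd (snd h)) = 0"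
      using h(2) eq by (simp add: line_def algebra_simps)
    then have "fst p = 0" using \<mu>[OF h(1)] by simp
    then have "p = 0" using eq by (simp add: prod_eq_iff)
    then show False using X p by simp
  qed
  then have "finite (\<Union>p\<in>X. {x. poly [:fst (snd p) - \<mu> * fst p, snd (snd p) - \<mu>\<^sup>2 * fst p:] x = 0})"
    using X by (intro finite_UN_I poly_roots_finite) auto
  then obtain \<nu> where "\<nu> \<notin> (\<Union>p\<in>X. {x. poly [:fst (snd p) - \<mu> * fst p, snd (snd p) - \<mu>\<^sup>2 * fst p:] x = 0})"
    using ex_new_if_finite[OF infinite_UNIV_alg_closed_field] by blast
  then show ?thesis using \<mu> by (intro exI[of _ \<mu>] exI[of _ \<nu>]) auto
qed

lemma fat_ideal_line_defect:
  fixes X :: "('k::alg_closed_field \<times> 'k \<times> 'k) set"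
  assumes X: "point_set X" and F: "finite \<F>" "\<F> \<subseteq> lines" and cover: "X \<subseteq> \<Union>\<F>"
  shows "\<exists>\<delta>. line_defect X \<F> \<delta> \<and>
    (\<forall>m d. 2 \<le> d \<longrightarrow> dhilb (fat_ideal m X) (int d - 1) = \<delta> (\<lambda>_. m) (d - 1) - \<delta> (\<lambda>_. m) d)"
proof -
  have fin: "finite X" "0 \<notin> X" using X by (auto simp: point_set_def)
  obtain \<A> where \<A>: "finite \<A>" "\<A> \<subseteq> {h. h \<noteq> 0}" "\<F> = line ` \<A>"
    using finite_subset_image[OF F(1), of line "{h. h \<noteq> 0}"] F(2) unfolding lines_eq by blast
  have "\<exists>\<mu> \<nu>. (\<forall>h\<in>\<A>. fst h + \<mu> * fst (snd h) + \<mu>\<^sup>2 * snd (snd h) \<noteq> 0) \<and>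
    (\<forall>p\<in>X. (fst (snd p) - \<mu> * fst p) + \<nu> * (snd (snd p) - \<mu>\<^sup>2 * fst p) \<noteq> 0)"
    by (rule generic_chart) (use fin \<A> cover in auto)
  then obtain \<mu> \<nu> where \<mu>: "\<And>h. h \<in> \<A> \<Longrightarrow> fst h + \<mu> * fst (snd h) + \<mu>\<^sup>2 * snd (snd h) \<noteq> 0"
    and \<nu>: "\<And>p. p \<in> X \<Longrightarrow> (fst (snd p) - \<mu> * fst p) + \<nu> * (snd (snd p) - \<mu>\<^sup>2 * fst p) \<noteq> 0" by blast
  \<comment> \<open>\<open>\<alpha> p\<close> is the value of \<open>fA\<close> at \<open>p\<close>:
    it is nonzero when \<open>p\<close> is not at infinity, and dividing by it gives the affine
    coordinates y = \<open>a p\<close> and z = \<open>b p\<close>.\<close>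
  define \<alpha> where "\<alpha> p = (fst (snd p) - \<mu> * fst p) + \<nu> * (snd (snd p) - \<mu>\<^sup>2 * fst p)" for p :: "'k \<times> 'k \<times> 'k"
  define a where "a p = (snd (snd p) - \<mu>\<^sup>2 * fst p) / \<alpha> p" for p
  define b where "b p = fst p / \<alpha> p" for p
  have \<alpha>: "\<alpha> p \<noteq> 0" if "p \<in> X" for p using \<nu>[OF that] by (simp add: \<alpha>_def)
  have coord: "fst p = \<alpha> p * b p" "fst (snd p) = \<alpha> p * (1 - \<nu> * a p + \<mu> * b p)" "snd (snd p) = \<alpha> p * (a p + \<mu>\<^sup>2 * b p)"
    if "p \<in> X" for p
  proof -
    have a: "\<alpha> p * a p = snd (snd p) - \<mu>\<^sup>2 * fst p" and b: "\<alpha> p * b p = fst p" using \<alpha>[OF that] by (simp_all add: a_def b_def)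
    show "fst p = \<alpha> p * b p" using b by simp
    have "\<alpha> p * (1 - \<nu> * a p + \<mu> * b p) = \<alpha> p - \<nu> * (\<alpha> p * a p) + \<mu> * (\<alpha> p * b p)" by (simp add: algebra_simps)
    then show "fst (snd p) = \<alpha> p * (1 - \<nu> * a p + \<mu> * b p)" unfolding a b by (simp add: \<alpha>_def algebra_simps)
    have "\<alpha> p * (a p + \<mu>\<^sup>2 * b p) = \<alpha> p * a p + \<mu>\<^sup>2 * (\<alpha> p * b p)" by (simp add: algebra_simps)
    then show "snd (snd p) = \<alpha> p * (a p + \<mu>\<^sup>2 * b p)" unfolding a b by simp
  qed
  have pt: "proportional (chart_point \<mu> \<nu> (a p) (b p)) p" if "p \<in> X" for p
    unfolding proportional_def chart_point_def using coord[OF that] \<alpha>[OF that]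
    by (intro exI[of _ "\<alpha> p"]) (auto simp: prod_eq_iff)
  have inj: "inj_on (\<lambda>p. (a p, b p)) X"
  proof (rule inj_onI)
    fix p q assume pq: "p \<in> X" "q \<in> X" "(a p, b p) = (a q, b q)"
    have "proportional p q"
      unfolding proportional_def using coord[OF pq(1)] coord[OF pq(2)] \<alpha>[OF pq(1)] \<alpha>[OF pq(2)] pq(3)
      by (intro exI[of _ "\<alpha> q / \<alpha> p"]) (auto simp: prod_eq_iff)
    then show "p = q" using X pq by (simp add: point_set_def)
  qed
  have eq_line: "\<exists>c l. \<forall>p\<in>X. p \<in> A \<longleftrightarrow> b p = c + l * a p" if A: "A \<in> \<F>" for A
  proof -
    obtain h where h: "h \<in> \<A>" "A = line h" using A \<A> by blast
    have split: "(- u - v * x) / H = - u / H + (- v / H) * x" for u v x H :: 'k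
      by (simp add: diff_divide_distrib)
    \<comment> \<open>The value of \<open>h\<close> at (1, \<open>\<mu>\<close>,
      \<open>\<mu>\<^sup>2\<close>) is the coefficient of z in its chart equation, so the line can
      be solved for z.\<close>
    let ?H = "fst h + \<mu> * fst (snd h) + \<mu>\<^sup>2 * snd (snd h)"
    have "p \<in> A \<longleftrightarrow> b p = - fst (snd h) / ?H + (- (snd (snd h) - \<nu> * fst (snd h)) / ?H) * a p" if p: "p \<in> X" for p
    proof -
      have "p \<in> A \<longleftrightarrow> fst h * fst p + fst (snd h) * fst (snd p) + snd (snd h) * snd (snd p) = 0"
        using fin p h by (auto simp: line_def)
      also have "\<dots> \<longleftrightarrow> \<alpha> p * (?H * b p + fst (snd h) + (snd (snd h) - \<nu> * fst (snd h)) * a p) = 0"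
        unfolding coord[OF p] by (simp add: algebra_simps)
      also have "\<dots> \<longleftrightarrow> ?H * b p = - fst (snd h) - (snd (snd h) - \<nu> * fst (snd h)) * a p"
        using \<alpha>[OF p] eq_neg_iff_add_eq_0[of "?H * b p" "fst (snd h) + (snd (snd h) - \<nu> * fst (snd h)) * a p"]
        by (simp only: mult_eq_0_iff simp_thms add.assoc minus_add_distrib add_uminus_conv_diff)
      also have "\<dots> \<longleftrightarrow> b p = (- fst (snd h) - (snd (snd h) - \<nu> * fst (snd h)) * a p) / ?H"
        using \<mu>[OF h(1)] by (simp add: eq_divide_eq mult.commute)
      finally show ?thesis unfolding split .
    qed
    then show ?thesis by blast
  qed
  have "line_defect X \<F> (defect X a b)"
  proof
    show "meet_once X \<F>" using meet_once_lines[OF X] F(2) unfolding meet_once_def by blast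
    fix A n and d :: nat assume A: "A \<in> \<F>" and d: "0 < d"
    obtain c l where "\<And>p. p \<in> X \<Longrightarrow> p \<in> A \<longleftrightarrow> b p = c + l * a p" using eq_line[OF A] by blast
    note step = defect_step[OF fin(1) inj this d]
    show "(\<Sum>p\<in>X \<inter> A. n p) \<le> d \<Longrightarrow> defect X a b n d \<le> defect X a b (\<lambda>p. n p - of_bool (p \<in> A)) (d - 1)"
      by (rule step(1))
    show "d \<le> (\<Sum>p\<in>X \<inter> A. n p) \<Longrightarrow> defect X a b n d = defect X a b (\<lambda>p. n p - of_bool (p \<in> A)) (d - 1) + (int (\<Sum>p\<in>X \<inter> A. n p) - int d)"
      by (rule step(2))
  qed (auto intro: defect_nonneg[OF fin(1)] defect_zero)
  then show ?thesis using dhilb_fat_ideal[OF pt] by blast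
qed

theorem theorem4p7:
  fixes X :: "('k::alg_closed_field \<times> 'k \<times> 'k) set" and s r :: nat
  assumes "s \<ge> 2"
    and "k_configuration X [1..<s+1]"
    and "card {L \<in> lines. card (X \<inter> L) = s} = r"
    and "1 \<le> r" and "r < s"
  shows "\<forall>m::nat. m \<ge> s + 1 \<longrightarrow> dhilb (fat_ideal m X) (int (m * s) - 1) = int r"
proof (intro allI impI)
  fix m :: nat assume m: "s + 1 \<le> m"
  define R where "R = {L \<in> lines. card (X \<inter> L) = s}"
  have X: "point_set X" using assms(2) by (simp add: k_configuration_def)
  have once: "meet_once X lines" by (rule meet_once_lines[OF X])
  have len: "length [1..<s + 1] = s" and nth: "\<And>i. i < s \<Longrightarrow> [1..<s + 1] ! i = Suc i" by (simp_all del: upt_Suc)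
  have "\<exists>Xs L. X = (\<Union>i<s. Xs i) \<and> (\<forall>i<s. card (Xs i) = [1..<s + 1] ! i \<and> L i \<in> lines \<and> Xs i \<subseteq> L i) \<and>
      (\<forall>i<s. \<forall>j<s. i \<noteq> j \<longrightarrow> L i \<noteq> L j) \<and> (\<forall>i<s. \<forall>j<i. L i \<inter> Xs j = {})"
    using assms(2) unfolding k_configuration_def len by (elim conjE)
  then obtain Xs' L' where "X = (\<Union>i<s. Xs' i)"
    "\<forall>i<s. card (Xs' i) = [1..<s + 1] ! i \<and> L' i \<in> lines \<and> Xs' i \<subseteq> L' i" "\<forall>i<s. \<forall>j<i. L' i \<inter> Xs' j = {}"
    by blast
  then have "layered X lines s Xs' L'" unfolding layered_def using nth by metis
  \<comment> \<open>An infinite set has cardinality 0, so \<open>1 <= r\<close> yields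
    finiteness.\<close>
  moreover have "finite R" using assms(3,4) by (intro card_ge_0_finite) (simp add: R_def)
  moreover have "card R = r" "\<And>A. A \<in> R \<Longrightarrow> card (X \<inter> A) = s" "R \<subseteq> lines" using assms(3) by (auto simp: R_def)
  ultimately have "\<exists>Xs L. layered X lines s Xs L \<and> L ` {s - r..<s} = R"
    using rich_lines_on_top[of X lines s Xs' L' R] once assms(5) by simp
  then obtain Xs L where lay: "layered X lines s Xs L" and top: "L ` {s - r..<s} = R" by blast
  have rich: "card (X \<inter> L i) = s" if "s - r \<le> i" "i < s" for i
  proof -
    have "L i \<in> R" using that top by auto
    then show ?thesis by (simp add: R_def)
  qed
  have poor: "card (X \<inter> L i) < s" if i: "i < s - r" for i
  proof (rule ccontr)
    assume "\<not> card (X \<inter> L i) < s"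
    then have "L i \<in> R" using card_line_le[OF lay once layeredD(4)[OF lay, of i]] layeredD(4)[OF lay, of i] i by (simp add: R_def)
    then obtain j where "s - r \<le> j" "j < s" "L i = L j" using top by auto
    then show False using layered_lines_distinct[OF lay, of i j] i by simp
  qed
  have "card (Xs 0) = 1" using layeredD(2)[OF lay, of 0] assms(1) by simp
  then obtain w where w: "Xs 0 = {w}" by (rule card_1_singletonE)
  have "card (Xs 1) = 2" using layeredD(2)[OF lay, of 1] assms(1) by simp
  then obtain p q where pq: "Xs 1 = {p, q}" "p \<noteq> q" unfolding card_2_iff by blast
  have in_X: "w \<in> X" "p \<in> X" "q \<in> X" using layeredD(8)[OF lay, of 0] layeredD(8)[OF lay, of 1] w pq assms(1) by auto
  have neq: "w \<noteq> p" "w \<noteq> q" using layered_disjoint[OF lay, of 0 1] w pq assms(1) by auto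
  have through_w: "card (X \<inter> H) < s" if H: "H \<in> lines" "w \<in> H" for H
  proof (rule ccontr)
    assume "\<not> card (X \<inter> H) < s"
    then have "H \<in> R" using card_line_le[OF lay once H(1)] H(1) by (simp add: R_def)
    then obtain j where j: "s - r \<le> j" "j < s" "H = L j" using top by auto
    then have "L j \<inter> Xs 0 = {}" using layeredD(6)[OF lay, of j 0] assms(5) by auto
    then show False using H(2) j(3) w by simp
  qed
  obtain H1 where H1: "H1 \<in> lines" "w \<in> H1" "p \<in> H1" using line_through[OF X in_X(1,2) neq(1)] by blast
  obtain H2 where H2: "H2 \<in> lines" "w \<in> H2" "q \<in> H2" using line_through[OF X in_X(1,3) neq(2)] by blast
  \<comment> \<open>The line \<open>H1\<close> has at least two and fewer than \<open>s\<close>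
    points of \<open>X\<close>, so \<open>s >= 3\<close>, and \<open>m >= s + 1\<close> gives
    \<open>M >= 2\<close>.\<close>
  have "card {w, p} \<le> card (X \<inter> H1)"
    using in_X H1 layeredD(7)[OF lay] by (intro card_mono) auto
  then have "3 \<le> s" using neq through_w[OF H1(1,2)] by simp
  define M where "M = m - 2"
  have M: "2 \<le> M" "m = M + 2" using m \<open>3 \<le> s\<close> by (auto simp: M_def)
  \<comment> \<open>All lines that are ever split off. They cover \<open>X\<close>, as the choice of
    a chart requires.\<close>
  define \<F> where "\<F> = L ` {..<s} \<union> {H1, H2}"
  have "X \<subseteq> \<Union>\<F>"
    using layeredD(1,5)[OF lay] unfolding \<F>_def by blast
  moreover have "finite \<F>" "\<F> \<subseteq> lines" using layeredD(4)[OF lay] H1 H2 by (auto simp: \<F>_def)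
  ultimately obtain \<delta> where "line_defect X \<F> \<delta>"
    and dhilb: "\<And>m d. 2 \<le> d \<Longrightarrow> dhilb (fat_ideal m X) (int d - 1) = \<delta> (\<lambda>_. m) (d - 1) - \<delta> (\<lambda>_. m) d"
    using fat_ideal_line_defect[OF X] by metis
  then interpret line_defect X \<F> \<delta> by simp
  have lay': "layered X \<F> s Xs L"
    using lay unfolding layered_def \<F>_def by auto
  have "\<delta> (\<lambda>_. M + 2) ((M + 2) * s - 1) = int r"
    by (rule defect_rich[OF lay' M(1) assms(1,5) poor w pq(1) _ _ H1(2,3) H2(2,3) through_w[OF H1(1,2)] through_w[OF H2(1,2)] rich])
      (auto simp: \<F>_def)
  moreover have "\<delta> (\<lambda>_. m) (m * s) = 0" by (rule defect_uniform[OF lay']) simp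
  moreover have "2 \<le> m * s" using assms(1) m mult_le_mono[of 1 m 2 s] by simp
  ultimately show "dhilb (fat_ideal m X) (int (m * s) - 1) = int r"
    using dhilb[of "m * s" m] M(2) by simp
qed

end
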